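(* Consider a $(g,F)$-process $(S_n)_{n\ge 0}$ which has negative mean and satisfies the standard assumption, with index $\gamma$ of regular variation of $g$ at $1$ satisfying $1/2<\gamma<1$. Assume furthermore that $-\log\overline F$ is regularly varying at infinity of index $\alpha$ greater than $1$ and that $\alpha\gamma<1$. Let $\beta$ be the conjugate exponent of $\alpha$, that is $\alpha^{-1}+\beta^{-1}=1$. Then the maximum $M=\max_{n\ge 0}S_n$ of the process satisfies $$\log \mathrm{P}\{M>t\}\sim |g|_\beta^{-\alpha}\,\log\overline F(t)$$ as $t$ tends to infinity.
   Context: Let $g$ be real analytic on $(-1,1)$ with Taylor expansion $g(x)=\sum_{i\ge 0} g_i x^i$, let $F$ be a distribution function on $\mathbb{R}$, and let $(X_i)_{i\ge 1}$ be independent random variables with common distribution function $F$. The $(g,F)$-process is $S_0=0$, $S_n=\sum_{0\le i<n} g_i X_{n-i}$. Write $\overline F=1-F$, $\varphi(\lambda)=\mathrm{E}e^{\lambda X_1}$, $m=(\log\varphi)'$ (the mean function), $\mu=\mathrm{E}X_1$. The process has negative mean if $\mu<0$. $g$ is regularly varying at $1$ of index $\gamma$ if $\lim_{t\to\infty} g(1-1/(\lambda t))/g(1-1/t)=\lambda^\gamma$ for every $\lambda>0$. Standard assumption: $g$ is regularly varying at $1$ of positive index and its coefficients $(g_i)_{i\ge 0}$ are nonnegative; $g_0\ne 0$; in case the sequence $(g_n)_{n\ge 0}$ converges to $0$, it is asymptotically equivalent to a monotone sequence; $F$ has a moment generating function finite on the nonnegative half-line; the image of the mean function $m$ contains $[0,\infty)$.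 $|g|_\beta=\bigl(\sum_{i\ge 0} g_i^\beta\bigr)^{1/\beta}$. *)

theory Defs
  imports "HOL-Probability.Probability" "HOL-Library.Landau_Symbols"
begin

text \<open>Below, \<open>G\<close> is the real analytic function on \<open>(-1,1)\<close> and \<open>g\<close> the sequence
  of its Taylor coefficients at \<open>0\<close>. The expansion is required to hold on all of \<open>(-1,1)\<close>,
  and analyticity of \<open>G\<close> there is a consequence. Values of \<open>G\<close> outside \<open>(-1,1)\<close> are irrelevant.
  The random variables are \<open>X 1, X 2, \<dots>\<close>; \<open>X 0\<close> is never used.\<close>

definition gF_setting ::
  "'a measure \<Rightarrow> (real \<Rightarrow> real) \<Rightarrow> (nat \<Rightarrow> real) \<Rightarrow> (real \<Rightarrow> real) \<Rightarrow> (nat \<Rightarrow> 'a \<Rightarrow> real) \<Rightarrow> bool" where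
  "gF_setting M G g F X \<longleftrightarrow>
     prob_space M \<and>
     (\<forall>x\<in>{-1<..<1}. (\<lambda>i. g i * x ^ i) sums G x) \<and>
     prob_space.indep_vars M (\<lambda>_. borel) X {1..} \<and>
     (\<forall>i\<ge>1. cdf (distr M borel (X i)) = F)"

definition gF_process :: "(nat \<Rightarrow> real) \<Rightarrow> (nat \<Rightarrow> 'a \<Rightarrow> real) \<Rightarrow> nat \<Rightarrow> 'a \<Rightarrow> real" where
  "gF_process g X n \<omega> = (\<Sum>i<n. g i * X (n - i) \<omega>)"

definition gF_max :: "(nat \<Rightarrow> real) \<Rightarrow> (nat \<Rightarrow> 'a \<Rightarrow> real) \<Rightarrow> 'a \<Rightarrow> ereal" where
  "gF_max g X \<omega> = (SUP n. ereal (gF_process g X n \<omega>))"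

text \<open>Only the positive part of \<open>X 1\<close> is made integrable by the assumptions, so the mean
  is taken in the extended sense and may be \<open>-\<infinity>\<close>. For integrable \<open>Y\<close> it is the usual
  expectation. In the undefined case \<open>\<infinity> - \<infinity>\<close>, \<^typ>\<open>ereal\<close> subtraction gives \<open>\<infinity>\<close>, which is
  not negative.\<close>

definition ext_mean :: "'a measure \<Rightarrow> ('a \<Rightarrow> real) \<Rightarrow> ereal" where
  "ext_mean M Y =
     enn2ereal (\<integral>\<^sup>+\<omega>. ennreal (Y \<omega>) \<partial>M) - enn2ereal (\<integral>\<^sup>+\<omega>. ennreal (- Y \<omega>) \<partial>M)"

definition mgf :: "'a measure \<Rightarrow> ('a \<Rightarrow> real) \<Rightarrow> real \<Rightarrow> real" where
  "mgf M Y s = integral\<^sup>L M (\<lambda>\<omega>. exp (s * Y \<omega>))"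

definition mgf_domain :: "'a measure \<Rightarrow> ('a \<Rightarrow> real) \<Rightarrow> real set" where
  "mgf_domain M Y = {s. integrable M (\<lambda>\<omega>. exp (s * Y \<omega>))}"

text \<open>The image of the mean function \<open>m = (log \<phi>)'\<close>. The moment generating function may be
  infinite on the negative half-line, so the derivative is taken within its domain of finiteness
  (one-sided at an end point), and points where it does not exist contribute no value. The domain
  contains \<open>[0,\<infinity>)\<close> wherever this is used, so that the derivative is unique.\<close>

definition mean_function_image :: "'a measure \<Rightarrow> ('a \<Rightarrow> real) \<Rightarrow> real set" where
  "mean_function_image M Y =
     {v. \<exists>l\<in>mgf_domain M Y.
        ((\<lambda>s. ln (mgf M Y s)) has_real_derivative v) (at l within mgf_domain M Y)}"

definition regularly_varying_at_1 :: "(real \<Rightarrow> real) \<Rightarrow> real \<Rightarrow> bool" where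
  "regularly_varying_at_1 G \<gamma> \<longleftrightarrow>
     (\<forall>c>0. ((\<lambda>t. G (1 - 1 / (c * t)) / G (1 - 1 / t)) \<longlongrightarrow> c powr \<gamma>) at_top)"

definition regularly_varying_at_infinity :: "(real \<Rightarrow> real) \<Rightarrow> real \<Rightarrow> bool" where
  "regularly_varying_at_infinity h \<alpha> \<longleftrightarrow>
     (\<forall>c>0. ((\<lambda>t. h (c * t) / h t) \<longlongrightarrow> c powr \<alpha>) at_top)"

definition standard_assumption ::
  "'a measure \<Rightarrow> (real \<Rightarrow> real) \<Rightarrow> (nat \<Rightarrow> real) \<Rightarrow> (nat \<Rightarrow> 'a \<Rightarrow> real) \<Rightarrow> real \<Rightarrow> bool" where
  "standard_assumption M G g X \<gamma> \<longleftrightarrow>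
     \<gamma> > 0 \<and> regularly_varying_at_1 G \<gamma> \<and>
     (\<forall>i. g i \<ge> 0) \<and> g 0 \<noteq> 0 \<and>
     (g \<longlonglongrightarrow> 0 \<longrightarrow> (\<exists>b. monoseq b \<and> g \<sim>[sequentially] b)) \<and>
     {0..} \<subseteq> mgf_domain M (X 1) \<and>
     {0..} \<subseteq> mean_function_image M (X 1)"

text \<open>The assumptions do not exclude \<open>|g|\<^sub>\<beta> = \<infinity>\<close> when \<open>g\<close> does not tend to \<open>0\<close> (sparse
  coefficients bounded away from \<open>0\<close> do not affect the regular variation), so the norm and its
  powers are extended real valued, with \<open>\<infinity>\<close> raised to a negative power being \<open>0\<close>.\<close>

definition ennreal_powr :: "ennreal \<Rightarrow> real \<Rightarrow> ennreal" where
  "ennreal_powr x p =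
     (if x = \<infinity> then (if p > 0 then \<infinity> else if p = 0 then 1 else 0)
      else if x = 0 \<and> p < 0 then \<infinity>
      else if p = 0 then 1
      else ennreal (enn2real x powr p))"

definition seq_norm :: "real \<Rightarrow> (nat \<Rightarrow> real) \<Rightarrow> ennreal" where
  "seq_norm \<beta> g = ennreal_powr (\<Sum>i. ennreal (\<bar>g i\<bar> powr \<beta>)) (1 / \<beta>)"

end

theory Submission
  imports Defs "HOL-Real_Asymp.Real_Asymp"
begin

text \<open>
Write \<open>P(X\<^sub>1 > x) = exp (- h x)\<close>, where \<open>h\<close> is nondecreasing and regularly varying of index \<open>\<alpha>\<close>, and put
\<open>B = \<Sum> g\<^sub>i\<^sup>\<beta>\<close>. As \<open>\<beta> = \<alpha> / (\<alpha> - 1)\<close>, the claimed constant is \<open>|g|\<^sub>\<beta>\<^bsup>-\<alpha>\<^esup> = B\<^bsup>1-\<alpha>\<^esup>\<close>, which is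
also the minimum of \<open>\<Sum> c\<^sub>i\<^sup>\<alpha>\<close> over \<open>c \<ge> 0\<close> with \<open>\<Sum> g\<^sub>i c\<^sub>i = 1\<close>, attained at \<open>c\<^sub>i = g\<^sub>i\<^bsup>\<beta>-1\<^esup> / B\<close>. The
process exceeds \<open>t\<close> in the cheapest way when finitely many of the variables contribute \<open>c\<^sub>i t\<close> each.

Lower bound. Fix \<open>N\<close>. If \<open>X\<^bsub>N-i\<^esub> > c\<^sub>i t\<close> for all \<open>i < N\<close>, then \<open>S\<^sub>N > t\<close>, and this event has
probability \<open>exp (- \<Sum> h (c\<^sub>i t))\<close>, with \<open>\<Sum> h (c\<^sub>i t) \<sim> h t \<Sum> c\<^sub>i\<^sup>\<alpha>\<close>. Optimising over \<open>c\<close> and letting \<open>N\<close>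
tend to infinity gives one half of the theorem (\<open>max_log_less\<close>). If \<open>B\<close> is infinite, the constant
is \<open>0\<close> and the other half is trivial. If \<open>B\<close> is finite then \<open>g\<close> tends to \<open>0\<close>, so that it is
asymptotically monotone, and regular variation of \<open>G\<close> gives \<open>g\<^sub>n = O(n\<^bsup>\<gamma>-1+\<eta>\<^esup>)\<close> for every \<open>\<eta> > 0\<close>.

Upper bound. By Chernoff's inequality
\<open>log P(S\<^sub>n > t) \<le> - \<lambda> t + \<Sum>\<^bsub>i<n\<^esub> log \<phi>(\<lambda> g\<^sub>i)\<close>. Take \<open>\<lambda> = \<theta> h(t) / t\<close>. The function \<open>log \<phi>\<close> is
bounded by the Legendre transform of a function \<open>a h(\<rho> x)\<close> with \<open>a\<close> and \<open>\<rho>\<close> close to \<open>1\<close>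
(\<open>mgf_le_legendre\<close>), and this transform can be computed with Potter's bounds: for fixed \<open>u\<close>,
\<open>log \<phi>(u h(t) / t) \<le> h(t) (\<psi>(u) + o(1))\<close>, where \<open>\<psi>(u) = sup\<^sub>w (u w - w\<^sup>\<alpha>)\<close> is a multiple of \<open>u\<^sup>\<beta>\<close>
(\<open>log_mgf_limsup\<close>). To sum over \<open>i\<close> one needs in addition a bound \<open>C h(t) u\<^sup>q\<close> that is uniform
for \<open>u\<close> in a bounded interval, with \<open>q < \<beta>\<close> as close to \<open>\<beta>\<close> as desired (\<open>log_mgf_dominated\<close>).
For small positive arguments \<open>log \<phi>\<close> is negative since the mean is negative, and \<open>\<Sum> g\<^sub>i\<^sup>q\<close> is finite for
some \<open>q < \<beta>\<close> because \<open>\<alpha> \<gamma> < 1\<close>, that is \<open>\<beta> (1 - \<gamma>) > 1\<close>. Hence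
\<open>log P(S\<^sub>n > t) \<le> - (\<theta> - B \<psi>(\<theta>) + o(1)) h(t)\<close> uniformly in \<open>n\<close>, and \<open>\<theta> = \<alpha> B\<^bsup>1-\<alpha>\<^esup>\<close> yields
\<open>\<theta> - B \<psi>(\<theta>) = B\<^bsup>1-\<alpha>\<^esup>\<close> (\<open>process_uniform_bound\<close>).

It remains to sum over \<open>n\<close>. With a small fixed \<open>\<lambda>\<close> the negative mean gives
\<open>P(S\<^sub>n > t) \<le> exp (- a \<Sum>\<^bsub>i<n\<^esub> g\<^sub>i)\<close>, and the partial sums of \<open>g\<close> grow at least like a power of \<open>n\<close>.
A geometric mean of the two bounds on \<open>P(S\<^sub>n > t)\<close>, with a small weight on the second one, is
summable in \<open>n\<close> and costs only a factor close to \<open>1\<close> in the exponent (\<open>max_upper_bound\<close>).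
\<close>

section \<open>Potter bounds for monotone regularly varying functions\<close>

text \<open>
Iterating the limit relation at one ratio \<open>r > 1\<close> controls \<open>h\<close> along \<open>t, r t, r\<^sup>2 t, \<dots>\<close>, and
monotonicity fills the gaps at the price of a factor \<open>r\<^bsup>p+\<eta>\<^esup>\<close>, which is close to \<open>1\<close> for \<open>r\<close> close
to \<open>1\<close>. Monotonicity thus replaces the uniform convergence theorem.
\<close>

lemma potter_bounds:
  fixes h :: "real \<Rightarrow> real"
  assumes mono: "\<And>x y. T0 \<le> x \<Longrightarrow> x \<le> y \<Longrightarrow> h x \<le> h y"
    and nonneg: "\<And>x. T0 \<le> x \<Longrightarrow> 0 \<le> h x"
    and rv: "regularly_varying_at_infinity h p"
    and p: "0 < \<eta>" "\<eta> < p"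
  obtains T where "T \<ge> T0" "T > 0" "\<And>t. t \<ge> T \<Longrightarrow> 0 < h t"
    "\<And>t y. t \<ge> T \<Longrightarrow> y \<ge> 1 \<Longrightarrow> (1 - \<eta>) * y powr (p - \<eta>) * h t \<le> h (y * t)"
    "\<And>t y. t \<ge> T \<Longrightarrow> y \<ge> 1 \<Longrightarrow> h (y * t) \<le> (1 + \<eta>) * y powr (p + \<eta>) * h t"
proof -
  \<comment> \<open>This ratio makes the loss in the last, incomplete step equal to \<open>1 + \<eta>\<close>.\<close>
  define r where "r = (1 + \<eta>) powr (1 / (p + \<eta>))"
  have r1: "r > 1" unfolding r_def using p by (intro gr_one_powr) auto
  have rup: "r powr (p + \<eta>) = 1 + \<eta>" unfolding r_def using p by (simp add: powr_powr)
  have rlo: "r powr (p - \<eta>) \<le> 1 + \<eta>"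
    using powr_mono[of "p - \<eta>" "p + \<eta>" r] r1 p rup by simp
  have lim: "((\<lambda>t. h (r * t) / h t) \<longlongrightarrow> r powr p) at_top"
    using rv r1 unfolding regularly_varying_at_infinity_def by auto
  have "\<forall>\<^sub>F t in at_top. h (r * t) / h t > r powr (p - \<eta>)"
    by (rule order_tendstoD(1)[OF lim]) (use r1 p in simp)
  moreover have "\<forall>\<^sub>F t in at_top. h (r * t) / h t < r powr (p + \<eta>)"
    by (rule order_tendstoD(2)[OF lim]) (use r1 p in simp)
  ultimately have "\<forall>\<^sub>F t in at_top. h (r * t) / h t > r powr (p - \<eta>) \<and>
      h (r * t) / h t < r powr (p + \<eta>)"
    by eventually_elim auto
  then obtain T1 where T1: "\<And>t. t \<ge> T1 \<Longrightarrow> h (r * t) / h t > r powr (p - \<eta>) \<and>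
      h (r * t) / h t < r powr (p + \<eta>)"
    by (auto simp: eventually_at_top_linorder)
  define T where "T = max (max T0 T1) 1"
  have T: "T \<ge> T0" "T \<ge> T1" "T > 0" by (auto simp: T_def)
  have pos: "0 < h t" if "t \<ge> T" for t
  proof -
    have "h t \<ge> 0" using nonneg that T by auto
    moreover have "h t \<noteq> 0"
      using T1[of t] that T r1 by (metis div_by_0 order.trans not_less_iff_gr_or_eq powr_gt_zero order.strict_trans)
    ultimately show ?thesis by simp
  qed
  have step: "r powr (p - \<eta>) * h t \<le> h (r * t)" "h (r * t) \<le> r powr (p + \<eta>) * h t" if "t \<ge> T" for t
    using T1[of t] pos[OF that] that T by (auto simp: field_simps)
  have iter: "(r powr k) powr (p - \<eta>) * h t \<le> h (r powr k * t) \<and>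
     h (r powr k * t) \<le> (r powr k) powr (p + \<eta>) * h t" if "t \<ge> T" for t and k :: nat
  proof (induction k)
    case 0 then show ?case using r1 by simp
  next
    case (Suc k)
    have e: "r powr real (Suc k) = r * r powr real k" using r1 by (simp add: powr_add)
    have "r powr k \<ge> 1" using r1 by (simp add: ge_one_powr_ge_zero)
    then have ge: "r powr k * t \<ge> T"
      using mult_right_mono[of 1 "r powr k" t] that T(3) by linarith
    have "(r powr real (Suc k)) powr (p - \<eta>) * h t = r powr (p - \<eta>) * ((r powr k) powr (p - \<eta>) * h t)"
      unfolding e using r1 by (simp add: powr_mult)
    also have "\<dots> \<le> r powr (p - \<eta>) * h (r powr k * t)"
      using Suc by (intro mult_left_mono) auto
    also have "\<dots> \<le> h (r * (r powr k * t))" using step(1)[OF ge] .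
    finally have 1: "(r powr real (Suc k)) powr (p - \<eta>) * h t \<le> h (r powr real (Suc k) * t)"
      by (metis e mult.assoc)
    have "h (r * (r powr k * t)) \<le> r powr (p + \<eta>) * h (r powr k * t)" using step(2)[OF ge] .
    also have "\<dots> \<le> r powr (p + \<eta>) * ((r powr k) powr (p + \<eta>) * h t)"
      using Suc by (intro mult_left_mono) auto
    also have "\<dots> = (r powr real (Suc k)) powr (p + \<eta>) * h t"
      unfolding e using r1 by (simp add: powr_mult)
    finally show ?case using 1 by (metis e mult.assoc)
  qed
  have main: "(1 - \<eta>) * y powr (p - \<eta>) * h t \<le> h (y * t)"
       "h (y * t) \<le> (1 + \<eta>) * y powr (p + \<eta>) * h t" if t: "t \<ge> T" and y: "y \<ge> 1" for t y
  proof -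
    define k where "k = nat \<lfloor>log r y\<rfloor>"
    have l0: "log r y \<ge> 0" using r1 y by simp
    have k: "real k \<le> log r y" "log r y < real k + 1"
      unfolding k_def using l0 by linarith+
    have yl: "y = r powr (log r y)" using r1 y by simp
    have k1: "r powr k \<le> y" using powr_mono[OF k(1), of r] r1 yl by simp
    have k2: "y \<le> r powr real (Suc k)" using powr_mono[of "log r y" "real (Suc k)" r] k(2) r1 yl by simp
    have e: "r powr real (Suc k) = r * r powr real k" using r1 by (simp add: powr_add)
    have ht: "h t > 0" "t > 0" using pos t T by auto
    have rk1: "r powr k \<ge> 1" using r1 by (simp add: ge_one_powr_ge_zero)
    have big: "T0 \<le> r powr k * t"
      using mult_right_mono[OF rk1, of t] t T(1) ht by linarith
    have "y powr (p - \<eta>) \<le> (r * r powr k) powr (p - \<eta>)"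
      using k2 p y unfolding e[symmetric] by (intro powr_mono2) auto
    also have "\<dots> = r powr (p - \<eta>) * (r powr k) powr (p - \<eta>)" using r1 by (simp add: powr_mult)
    also have "\<dots> \<le> (1 + \<eta>) * (r powr k) powr (p - \<eta>)" using rlo by (intro mult_right_mono) auto
    finally have A: "y powr (p - \<eta>) \<le> (1 + \<eta>) * (r powr k) powr (p - \<eta>)" .
    have "(1 - \<eta>) * y powr (p - \<eta>) \<le> (r powr k) powr (p - \<eta>)"
    proof (cases "\<eta> < 1")
      case True
      have "(1 - \<eta>) * y powr (p - \<eta>) \<le> (1 - \<eta>) * ((1 + \<eta>) * (r powr k) powr (p - \<eta>))"
        using A True by (intro mult_left_mono) auto
      also have "\<dots> = (1 - \<eta>\<^sup>2) * (r powr k) powr (p - \<eta>)" by (simp add: algebra_simps power2_eq_square)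
      also have "\<dots> \<le> 1 * (r powr k) powr (p - \<eta>)" by (intro mult_right_mono) auto
      finally show ?thesis by simp
    next
      case False
      then have "(1 - \<eta>) * y powr (p - \<eta>) \<le> 0" by (intro mult_nonpos_nonneg) auto
      then show ?thesis by (smt (verit) powr_ge_zero)
    qed
    then have "(1 - \<eta>) * y powr (p - \<eta>) * h t \<le> (r powr k) powr (p - \<eta>) * h t"
      using ht by (intro mult_right_mono) auto
    also have "\<dots> \<le> h (r powr k * t)" using iter[OF t, of k] by simp
    also have "\<dots> \<le> h (y * t)" using k1 ht big by (intro mono) auto
    finally show "(1 - \<eta>) * y powr (p - \<eta>) * h t \<le> h (y * t)" .
    have big2: "T0 \<le> y * t"
      using mult_right_mono[OF y, of t] t T(1) ht by linarith
    have "h (y * t) \<le> h (r powr real (Suc k) * t)" using k2 ht big2 by (intro mono) auto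
    also have "\<dots> \<le> (r powr real (Suc k)) powr (p + \<eta>) * h t" using iter[OF t, of "Suc k"] by simp
    also have "(r powr real (Suc k)) powr (p + \<eta>) = (1 + \<eta>) * (r powr k) powr (p + \<eta>)"
      unfolding e using r1 rup by (simp add: powr_mult)
    also have "(1 + \<eta>) * (r powr k) powr (p + \<eta>) * h t \<le> (1 + \<eta>) * y powr (p + \<eta>) * h t"
      using k1 p ht r1 by (intro mult_right_mono mult_left_mono powr_mono2) auto
    finally show "h (y * t) \<le> (1 + \<eta>) * y powr (p + \<eta>) * h t" .
  qed
  show ?thesis using that[OF T(1) T(3) pos main] by blast
qed

lemma regularly_varying_power_bounds:
  fixes h :: "real \<Rightarrow> real"
  assumes mono: "\<And>x y. T0 \<le> x \<Longrightarrow> x \<le> y \<Longrightarrow> h x \<le> h y"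
    and nonneg: "\<And>x. T0 \<le> x \<Longrightarrow> 0 \<le> h x"
    and rv: "regularly_varying_at_infinity h p"
    and p: "0 < \<eta>" "\<eta> < p" "\<eta> < 1"
  obtains c C where "c > 0" "C > 0"
    "\<forall>\<^sub>F t in at_top. c * t powr (p - \<eta>) \<le> h t \<and> h t \<le> C * t powr (p + \<eta>)"
proof (rule potter_bounds[of T0 h p \<eta>, OF mono nonneg rv p(1,2)])
  fix T assume T: "T \<ge> T0" "T > 0" "\<And>t. t \<ge> T \<Longrightarrow> 0 < h t"
    "\<And>t y. t \<ge> T \<Longrightarrow> y \<ge> 1 \<Longrightarrow> (1 - \<eta>) * y powr (p - \<eta>) * h t \<le> h (y * t)"
    "\<And>t y. t \<ge> T \<Longrightarrow> y \<ge> 1 \<Longrightarrow> h (y * t) \<le> (1 + \<eta>) * y powr (p + \<eta>) * h t"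
  define c where "c = (1 - \<eta>) * h T / T powr (p - \<eta>)"
  define C where "C = (1 + \<eta>) * h T / T powr (p + \<eta>)"
  have "\<forall>\<^sub>F t in at_top. c * t powr (p - \<eta>) \<le> h t \<and> h t \<le> C * t powr (p + \<eta>)"
    using eventually_ge_at_top[of T]
  proof eventually_elim
    case (elim t)
    then have "t / T \<ge> 1" "t > 0" using T(2) by auto
    then show ?case
      using T(4)[of T "t / T"] T(5)[of T "t / T"] T(2) by (simp add: c_def C_def powr_divide mult_ac)
  qed
  moreover have "c > 0" "C > 0" using T(2) T(3)[of T] p by (auto simp: c_def C_def)
  ultimately show thesis using that by blast
qed

section \<open>Coefficients of a regularly varying generating function\<close>

lemma generating_function_mono:
  fixes g :: "nat \<Rightarrow> real"
  assumes sums: "\<And>x. x \<in> {-1<..<1} \<Longrightarrow> (\<lambda>i. g i * x ^ i) sums G x"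
    and nn: "\<And>i. g i \<ge> 0" and xy: "0 \<le> x" "x \<le> y" "y < 1"
  shows "0 \<le> G x" "G x \<le> G y"
proof -
  have sx: "(\<lambda>i. g i * x ^ i) sums G x" and sy: "(\<lambda>i. g i * y ^ i) sums G y" using sums xy by auto
  show "0 \<le> G x" by (rule sums_le[OF _ sums_zero sx]) (use nn xy in auto)
  show "G x \<le> G y" by (rule sums_le[OF _ sx sy]) (use nn xy in \<open>auto intro!: mult_left_mono power_mono\<close>)
qed

text \<open>
At \<open>x = 1 - 1 / (2 n)\<close> the weights \<open>x\<^sup>i\<close> with \<open>i < n\<close> are at least \<open>1 / 2\<close>, by Bernoulli's inequality.
\<close>

lemma coefficient_sum_le:
  fixes g :: "nat \<Rightarrow> real"
  assumes sums: "\<And>x. x \<in> {-1<..<1} \<Longrightarrow> (\<lambda>i. g i * x ^ i) sums G x"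
    and nn: "\<And>i. g i \<ge> 0" and n: "n > 0"
  shows "(\<Sum>i<n. g i) \<le> 2 * G (1 - 1 / (2 * real n))"
proof -
  define x where "x = 1 - 1 / (2 * real n)"
  have x: "0 \<le> x" "x < 1" using n by (auto simp: x_def field_simps)
  have s: "(\<lambda>i. g i * x ^ i) sums G x" using sums x by auto
  have "x ^ i \<ge> 1 / 2" if "i < n" for i
  proof -
    have "1 + real i * (- 1 / (2 * real n)) \<le> (1 + (- 1 / (2 * real n))) ^ i"
      using n by (intro Bernoulli_inequality) (auto simp: field_simps)
    moreover have "real i * (1 / (2 * real n)) \<le> 1 / 2" using that n by (simp add: field_simps)
    ultimately show ?thesis by (simp add: x_def)
  qed
  then have "(\<Sum>i<n. g i * (1/2)) \<le> (\<Sum>i<n. g i * x ^ i)"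
    using nn by (intro sum_mono mult_left_mono) auto
  also have "\<dots> \<le> G x"
    using sum_le_suminf[OF sums_summable[OF s], of "{..<n}"] nn x sums_unique[OF s] by auto
  finally show ?thesis by (simp add: x_def sum_divide_distrib[symmetric])
qed

text \<open>
An Abelian estimate in the other direction: only the terms up to \<open>n\<close> matter once \<open>x\<^sup>n\<close> is small
compared with \<open>1 - x\<close>.
\<close>

lemma generating_function_le:
  fixes g :: "nat \<Rightarrow> real"
  assumes sums: "\<And>x. x \<in> {-1<..<1} \<Longrightarrow> (\<lambda>i. g i * x ^ i) sums G x"
    and nn: "\<And>i. g i \<ge> 0" and bd: "\<And>i. g i \<le> K" and x: "0 \<le> x" "x < 1"
  shows "G x \<le> (\<Sum>i<n. g i) + K * x ^ n / (1 - x)"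
proof -
  have s: "(\<lambda>i. g i * x ^ i) sums G x" using sums x by auto
  have "K \<ge> 0" using nn bd order_trans by blast
  have gs: "(\<lambda>i. x ^ i) sums (1 / (1 - x))" using geometric_sums[of x] x by auto
  have "G x = (\<Sum>i. g (i + n) * x ^ (i + n)) + (\<Sum>i<n. g i * x ^ i)"
    using suminf_split_initial_segment[OF sums_summable[OF s], of n] sums_unique[OF s] by simp
  also have "(\<Sum>i. g (i + n) * x ^ (i + n)) \<le> (\<Sum>i. K * x ^ n * x ^ i)"
  proof (rule suminf_le)
    show "g (i + n) * x ^ (i + n) \<le> K * x ^ n * x ^ i" for i
      using mult_right_mono[OF bd[of "i+n"], of "x ^ (i + n)"] x by (simp add: power_add mult_ac)
    show "summable (\<lambda>i. g (i + n) * x ^ (i + n))"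
      using sums_summable[OF s] by (subst summable_iff_shift)
    show "summable (\<lambda>i. K * x ^ n * x ^ i)" using sums_summable[OF gs] by (rule summable_mult)
  qed
  also have "(\<Sum>i. K * x ^ n * x ^ i) = K * x ^ n / (1 - x)"
    using sums_unique[OF sums_mult[OF gs, of "K * x ^ n"]] by simp
  also have "(\<Sum>i<n. g i * x ^ i) \<le> (\<Sum>i<n. g i)"
    using nn x by (intro sum_mono) (auto simp: mult_left_le power_le_one)
  finally show ?thesis by linarith
qed

text \<open>
A Tauberian theorem would give the exact order of the partial sums of \<open>g\<close>. Summability requires only
that they dominate some power of \<open>n\<close>, and for this it is enough to evaluate \<open>G\<close> at \<open>1 - 1 / \<surd>n\<close>,
whose distance from \<open>1\<close> is so much larger than \<open>1 / n\<close> that the terms of index at least \<open>n\<close> are negligible.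
\<close>

lemma summable_exp_coefficient_sums:
  fixes g :: "nat \<Rightarrow> real"
  assumes sums: "\<And>x. x \<in> {-1<..<1} \<Longrightarrow> (\<lambda>i. g i * x ^ i) sums G x"
    and nn: "\<And>i. g i \<ge> 0" and bd: "\<And>i. g i \<le> K"
    and lower: "c > 0" "s > 0" "\<forall>\<^sub>F t in at_top. c * t powr s \<le> G (1 - 1 / t)"
    and a: "a > 0"
  shows "summable (\<lambda>n. exp (- a * (\<Sum>i<n. g i)))"
proof -
  have K: "K \<ge> 0" using nn bd order_trans by blast
  have "filterlim (\<lambda>n. sqrt (real n)) at_top sequentially" by real_asymp
  from eventually_compose_filterlim[OF lower(3) this]
  have "\<forall>\<^sub>F n in sequentially. c * sqrt (real n) powr s \<le> G (1 - 1 / sqrt (real n))" .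
  moreover have "\<forall>\<^sub>F n in sequentially. sqrt (real n) * exp (- sqrt (real n)) \<le> 1" by real_asymp
  moreover have "\<forall>\<^sub>F n in sequentially. exp (- a * (c * sqrt (real n) powr s - K)) \<le> 1 / (real n)^2"
    using a lower(1,2) by real_asymp
  moreover have "\<forall>\<^sub>F n in sequentially. n > (1::nat)" by (rule eventually_gt_at_top)
  ultimately have "\<forall>\<^sub>F n in sequentially. norm (exp (- a * (\<Sum>i<n. g i))) \<le> 1 / (real n)^2"
  proof eventually_elim
    case (elim n)
    \<comment> \<open>The remainder \<open>K x (1 - 1 / x)\<^sup>n\<close> is at most \<open>K x exp (- n / x) = K x exp (- x)\<close>.\<close>
    define x where "x = sqrt (real n)"
    have x: "x > 1" "x * x = real n" using elim by (auto simp: x_def)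
    have "(1 - 1 / x) ^ n \<le> exp (- 1 / x) ^ n"
      using x exp_ge_add_one_self[of "-1/x"] by (intro power_mono) auto
    also have "\<dots> = exp (- x)" using x by (simp add: exp_of_nat_mult[symmetric] field_simps)
    finally have "K * ((1 - 1 / x) ^ n * x) \<le> K * (exp (- x) * x)"
      using K x by (intro mult_left_mono mult_right_mono) auto
    also have "\<dots> \<le> K * 1" using elim K by (intro mult_left_mono) (auto simp: x_def mult.commute)
    finally have 1: "K * (1 - 1 / x) ^ n / (1 - (1 - 1 / x)) \<le> K" using x by simp
    have "c * x powr s \<le> (\<Sum>i<n. g i) + K * (1 - 1 / x) ^ n / (1 - (1 - 1 / x))"
      using elim(1) generating_function_le[OF sums nn bd, of "1 - 1 / x" n] x by (simp add: x_def)
    with 1 have "c * x powr s - K \<le> (\<Sum>i<n. g i)" by linarith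
    then have "exp (- a * (\<Sum>i<n. g i)) \<le> exp (- a * (c * x powr s - K))" using a by simp
    also have "\<dots> \<le> 1 / (real n)^2" using elim(3) by (simp add: x_def)
    finally show ?case by simp
  qed
  moreover have "summable (\<lambda>n. 1 / (real n)^2)"
    using inverse_power_summable[of 2, where 'a=real] by (simp add: inverse_eq_divide)
  ultimately show ?thesis by (rule summable_comparison_test_ev)
qed

text \<open>
A nonnegative sequence that tends to \<open>0\<close> cannot be equivalent to an increasing sequence, unless both
vanish eventually.
\<close>

lemma asymp_monotone_imp_almost_decreasing:
  fixes g :: "nat \<Rightarrow> real"
  assumes nn: "\<And>i. g i \<ge> 0" and lim: "g \<longlonglongrightarrow> 0" and b: "monoseq b" "g \<sim>[sequentially] b"
  obtains N where "\<And>i n. N \<le> i \<Longrightarrow> i \<le> n \<Longrightarrow> g n \<le> 4 * g i"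
proof -
  have blim: "b \<longlonglongrightarrow> 0" using lim b(2) by (metis asymp_equiv_tendsto_transfer asymp_equiv_sym)
  have "\<forall>\<^sub>F n in sequentially. (if g n = 0 \<and> b n = 0 then 1 else g n / b n) \<in> {1/2<..<2}"
    using b(2)[unfolded asymp_equiv_def] by (rule topological_tendstoD) auto
  then obtain N where N: "\<And>n. n \<ge> N \<Longrightarrow> (if g n = 0 \<and> b n = 0 then 1 else g n / b n) \<in> {1/2<..<2}"
    by (auto simp: eventually_sequentially)
  have bd: "0 \<le> b n \<and> b n / 2 \<le> g n \<and> g n \<le> 2 * b n" if "n \<ge> N" for n
  proof (cases "g n = 0 \<and> b n = 0")
    case False
    then have r: "1/2 < g n / b n" "g n / b n < 2" using N[OF that] by auto
    have "b n > 0" using r(1) nn[of n]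
      by (smt (verit, best) divide_nonneg_nonpos zero_less_divide_1_iff)
    then show ?thesis using r by (auto simp: field_simps)
  qed auto
  have "g n \<le> 4 * g i" if "N \<le> i" "i \<le> n" for i n
  proof (cases "\<forall>m k. m \<le> k \<longrightarrow> b m \<le> b k")
    case True
    then have "b n \<le> 0" using blim incseq_le[of b 0 n] by (auto simp: incseq_def)
    then show ?thesis using bd[of n] nn[of i] nn[of n] that by linarith
  next
    case False
    then have "b n \<le> b i" using b(1) that by (auto simp: monoseq_def)
    then show ?thesis using bd[of n] bd[of i] that by linarith
  qed
  then show ?thesis using that by blast
qed

text \<open>
If \<open>g\<close> is decreasing up to a constant, then \<open>n g\<^sub>n\<close> is bounded by a multiple of the \<open>n\<close>-th partial sum
of \<open>g\<close>, which \<open>coefficient_sum_le\<close> controls through \<open>G\<close>.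
\<close>

lemma coefficient_le_powr:
  fixes g :: "nat \<Rightarrow> real"
  assumes sums: "\<And>x. x \<in> {-1<..<1} \<Longrightarrow> (\<lambda>i. g i * x ^ i) sums G x"
    and nn: "\<And>i. g i \<ge> 0"
    and dec: "\<And>i n. N \<le> i \<Longrightarrow> i \<le> n \<Longrightarrow> g n \<le> 4 * g i"
    and upper: "\<forall>\<^sub>F t in at_top. G (1 - 1 / t) \<le> C * t powr s"
  shows "\<forall>\<^sub>F n in sequentially. g n \<le> 16 * C * 2 powr s * real n powr (s - 1)"
proof -
  have "filterlim (\<lambda>n. 2 * real n) at_top sequentially" by real_asymp
  from eventually_compose_filterlim[OF upper this]
  have "\<forall>\<^sub>F n in sequentially. G (1 - 1 / (2 * real n)) \<le> C * (2 * real n) powr s" .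
  moreover have "\<forall>\<^sub>F n in sequentially. n \<ge> 2 * N + 1" by (rule eventually_ge_at_top)
  ultimately show ?thesis
  proof eventually_elim
    case (elim n)
    have "real (n - N) * g n = (\<Sum>i\<in>{N..<n}. g n)" by simp
    also have "\<dots> \<le> (\<Sum>i\<in>{N..<n}. 4 * g i)" by (intro sum_mono dec) auto
    also have "\<dots> \<le> (\<Sum>i<n. 4 * g i)" using nn by (intro sum_mono2) auto
    also have "\<dots> \<le> 4 * (2 * G (1 - 1 / (2 * real n)))"
      using coefficient_sum_le[OF sums nn, of n] elim by (simp add: sum_distrib_left[symmetric])
    also have "\<dots> \<le> 8 * (C * (2 * real n) powr s)" using elim by simp
    finally have 1: "real (n - N) * g n \<le> 8 * (C * (2 * real n) powr s)" .
    have "real n / 2 * g n \<le> real (n - N) * g n" using elim nn by (intro mult_right_mono) auto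
    with 1 have "g n * real n \<le> 16 * C * (2 * real n) powr s" by (simp add: mult_ac)
    then have "g n \<le> 16 * C * (2 * real n) powr s / real n" using elim by (simp add: field_simps)
    also have "\<dots> = 16 * C * 2 powr s * real n powr (s - 1)"
      using elim by (simp add: powr_mult powr_diff)
    finally show ?case .
  qed
qed

text \<open>
The exponent \<open>q = (\<alpha> + \<eta>) / (\<alpha> + \<eta> - 1)\<close> is conjugate to \<open>\<alpha> + \<eta>\<close> and is slightly smaller than the conjugate
exponent \<open>\<beta>\<close> of \<open>\<alpha>\<close>. Since \<open>g\<^sub>n = O(n\<^bsup>\<gamma>-1+\<eta>\<^esup>)\<close>, summability of \<open>g\<^sub>i\<^sup>q\<close> follows from
\<open>(1 - \<gamma> - \<eta>) q > 1\<close>. For \<open>\<eta> = 0\<close> this reads \<open>\<alpha> \<gamma> < 1\<close>, and it persists for small \<open>\<eta>\<close>.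
\<close>

lemma regularly_varying_coefficients:
  fixes g :: "nat \<Rightarrow> real"
  assumes sums: "\<And>x. x \<in> {-1<..<1} \<Longrightarrow> (\<lambda>i. g i * x ^ i) sums G x"
    and nn: "\<And>i. g i \<ge> 0" and rv: "regularly_varying_at_1 G \<gamma>" and \<gamma>: "0 < \<gamma>"
    and \<alpha>: "1 < \<alpha>" "\<alpha> * \<gamma> < 1"
    and lim: "g \<longlonglongrightarrow> 0" and b: "monoseq b" "g \<sim>[sequentially] b"
  obtains \<eta> where "0 < \<eta>" "\<eta> < 1" "\<eta> < \<alpha> - 1" "summable (\<lambda>i. g i powr ((\<alpha> + \<eta>) / (\<alpha> + \<eta> - 1)))"
    "\<And>a. a > 0 \<Longrightarrow> summable (\<lambda>n. exp (- a * (\<Sum>i<n. g i)))"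
proof -
  have "((\<lambda>\<eta>. (1 - \<gamma> - \<eta>) * ((\<alpha> + \<eta>) / (\<alpha> + \<eta> - 1))) \<longlongrightarrow> (1 - \<gamma> - 0) * ((\<alpha> + 0) / (\<alpha> + 0 - 1))) (at_right 0)"
    by (intro tendsto_intros tendsto_ident_at) (use \<alpha> in auto)
  moreover have "(1 - \<gamma> - 0) * ((\<alpha> + 0) / (\<alpha> + 0 - 1)) > 1" using \<alpha> by (simp add: field_simps)
  ultimately have "\<forall>\<^sub>F \<eta> in at_right 0. (1 - \<gamma> - \<eta>) * ((\<alpha> + \<eta>) / (\<alpha> + \<eta> - 1)) > 1"
    by (rule order_tendstoD(1))
  moreover have "\<forall>\<^sub>F \<eta> in at_right 0. 0 < \<eta> \<and> \<eta> < min 1 (min \<gamma> (\<alpha> - 1))"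
    unfolding eventually_at_right_field using \<alpha> \<gamma> by (intro exI[of _ "min 1 (min \<gamma> (\<alpha> - 1))"]) auto
  ultimately have "\<forall>\<^sub>F \<eta> in at_right 0. (1 - \<gamma> - \<eta>) * ((\<alpha> + \<eta>) / (\<alpha> + \<eta> - 1)) > 1 \<and>
      0 < \<eta> \<and> \<eta> < min 1 (min \<gamma> (\<alpha> - 1))" by eventually_elim auto
  then obtain \<eta> where \<eta>: "(1 - \<gamma> - \<eta>) * ((\<alpha> + \<eta>) / (\<alpha> + \<eta> - 1)) > 1" "0 < \<eta>" "\<eta> < 1" "\<eta> < \<gamma>" "\<eta> < \<alpha> - 1"
    using eventually_happens'[OF trivial_limit_at_right_real] by fastforce
  define q where "q = (\<alpha> + \<eta>) / (\<alpha> + \<eta> - 1)"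
  define H where "H t = G (1 - 1 / t)" for t
  have rvH: "regularly_varying_at_infinity H \<gamma>"
    using rv unfolding regularly_varying_at_1_def regularly_varying_at_infinity_def H_def .
  have Hm: "H x \<le> H y" if "1 \<le> x" "x \<le> y" for x y
    unfolding H_def by (rule generating_function_mono(2)[OF sums nn]) (use that in \<open>auto simp: field_simps\<close>)
  have H0: "0 \<le> H x" if "1 \<le> x" for x
    unfolding H_def by (rule generating_function_mono(1)[OF sums nn, of _ "1 - 1 / x"]) (use that in \<open>auto simp: field_simps\<close>)
  obtain c C where cC: "c > 0" "C > 0"
    "\<forall>\<^sub>F t in at_top. c * t powr (\<gamma> - \<eta>) \<le> H t \<and> H t \<le> C * t powr (\<gamma> + \<eta>)"
    using regularly_varying_power_bounds[of 1 H \<gamma> \<eta>, OF Hm H0 rvH \<eta>(2,4,3)] by blast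
  obtain N where N: "\<And>i n. N \<le> i \<Longrightarrow> i \<le> n \<Longrightarrow> g n \<le> 4 * g i"
    using asymp_monotone_imp_almost_decreasing[OF nn lim b] by blast
  have "\<forall>\<^sub>F t in at_top. G (1 - 1 / t) \<le> C * t powr (\<gamma> + \<eta>)"
    using cC(3) by eventually_elim (simp add: H_def)
  from coefficient_le_powr[OF sums nn N this]
  have gle: "\<forall>\<^sub>F n in sequentially. g n \<le> 16 * C * 2 powr (\<gamma> + \<eta>) * real n powr (\<gamma> + \<eta> - 1)" by simp
  define D where "D = 16 * C * 2 powr (\<gamma> + \<eta>)"
  have D: "D > 0" using cC by (simp add: D_def)
  have q0: "q > 0" using \<eta> \<alpha> by (simp add: q_def)
  have "summable (\<lambda>i. g i powr q)"
  proof (rule summable_comparison_test_ev)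
    show "\<forall>\<^sub>F n in sequentially. norm (g n powr q) \<le> D powr q * real n powr ((\<gamma> + \<eta> - 1) * q)"
      using gle
    proof eventually_elim
      case (elim n)
      have "g n powr q \<le> (D * real n powr (\<gamma> + \<eta> - 1)) powr q"
        using elim nn q0 unfolding D_def by (intro powr_mono2) auto
      also have "\<dots> = D powr q * real n powr ((\<gamma> + \<eta> - 1) * q)"
        using D by (simp add: powr_mult powr_powr)
      finally show ?case by simp
    qed
    have "(\<gamma> + \<eta> - 1) * q < - 1" using \<eta>(1) unfolding q_def[symmetric] by (simp add: algebra_simps)
    then show "summable (\<lambda>n. D powr q * real n powr ((\<gamma> + \<eta> - 1) * q))"
      by (intro summable_mult) (simp add: summable_real_powr_iff)
  qed
  moreover obtain K where K: "\<And>i. g i \<le> K"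
    using convergent_imp_Bseq[OF convergentI[OF lim]] unfolding Bseq_def by (auto simp: abs_le_iff)
  have "\<forall>\<^sub>F t in at_top. c * t powr (\<gamma> - \<eta>) \<le> G (1 - 1 / t)"
    using cC(3) by eventually_elim (simp add: H_def)
  then have "summable (\<lambda>n. exp (- a * (\<Sum>i<n. g i)))" if "a > 0" for a
    using summable_exp_coefficient_sums[OF sums nn K cC(1), of "\<gamma> - \<eta>" a] \<eta> that by simp
  ultimately show ?thesis using that[of \<eta>] \<eta> unfolding q_def by blast
qed

section \<open>The moment generating function near zero under a negative mean\<close>

lemma ext_mean_eq_expectation:
  assumes "integrable M Y"
  shows "ext_mean M Y = ereal (integral\<^sup>L M Y)"
proof -
  have f: "(\<integral>\<^sup>+\<omega>. ennreal (Y \<omega>) \<partial>M) \<noteq> \<infinity>" "(\<integral>\<^sup>+\<omega>. ennreal (- Y \<omega>) \<partial>M) \<noteq> \<infinity>"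
    using assms by (auto simp: real_integrable_def)
  then obtain a b where ab: "(\<integral>\<^sup>+\<omega>. ennreal (Y \<omega>) \<partial>M) = ennreal a" "a \<ge> 0"
      "(\<integral>\<^sup>+\<omega>. ennreal (- Y \<omega>) \<partial>M) = ennreal b" "b \<ge> 0"
    by (metis ennreal_cases infinity_ennreal_def)
  show ?thesis unfolding ext_mean_def real_lebesgue_integral_def[OF assms]
    using ab by (simp add: enn2ereal_ennreal)
qed

text \<open>
The difference quotients \<open>k (\<phi>(1/k) - 1)\<close> decrease to the mean, which may be \<open>-\<infinity>\<close>. If they were all
nonnegative, Fatou's lemma would show that \<open>Y\<close> is integrable with a nonnegative expectation.
\<close>

lemma (in prob_space) negative_mean_imp_mgf_less_1:
  fixes Y :: "'a \<Rightarrow> real"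
  assumes rv [measurable]: "random_variable borel Y" and neg: "ext_mean M Y < 0"
    and int: "\<And>s. s \<ge> 0 \<Longrightarrow> integrable M (\<lambda>\<omega>. exp (s * Y \<omega>))"
  obtains s where "s > 0" "mgf M Y s < 1"
proof (rule ccontr)
  assume "\<not> thesis"
  then have no: "mgf M Y s \<ge> 1" if "s > 0" for s using that \<open>\<And>s. 0 < s \<Longrightarrow> mgf M Y s < 1 \<Longrightarrow> thesis\<close> by force
  \<comment> \<open>Nonnegative by Bernoulli's inequality, with limit \<open>exp y - 1 - y\<close>, as Fatou's lemma requires.\<close>
  define d where "d k y = exp y - 1 - real (Suc k) * (exp (y / real (Suc k)) - 1)" for k and y :: real
  have d0: "d k y \<ge> 0" for k y
  proof -
    have "1 + real (Suc k) * (exp (y / real (Suc k)) - 1) \<le> (1 + (exp (y / real (Suc k)) - 1)) ^ Suc k"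
      by (rule Bernoulli_inequality) simp
    also have "\<dots> = exp y" by (simp add: exp_of_nat_mult[symmetric] del: of_nat_Suc power_Suc)
    finally show ?thesis by (simp add: d_def)
  qed
  have lim: "(\<lambda>k. d k y) \<longlonglongrightarrow> exp y - 1 - y" for y
    unfolding d_def by (cases y "0::real" rule: linorder_cases; (simp; fail)?; real_asymp)
  have int1: "integrable M (\<lambda>\<omega>. exp (Y \<omega>))" using int[of 1] by simp
  have intk: "integrable M (\<lambda>\<omega>. exp (Y \<omega> / real (Suc k)))" for k
    using int[of "1 / real (Suc k)"] by simp
  have nnk: "(\<integral>\<^sup>+\<omega>. ennreal (d k (Y \<omega>)) \<partial>M) \<le> ennreal (mgf M Y 1 - 1)" for k
  proof -
    have i: "integrable M (\<lambda>\<omega>. d k (Y \<omega>))" unfolding d_def using int1 intk[of k] by simp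
    have "(\<integral>\<^sup>+\<omega>. ennreal (d k (Y \<omega>)) \<partial>M) = ennreal (\<integral>\<omega>. d k (Y \<omega>) \<partial>M)"
      using d0 i by (intro nn_integral_eq_integral) auto
    also have "(\<integral>\<omega>. d k (Y \<omega>) \<partial>M) = mgf M Y 1 - 1 - real (Suc k) * (mgf M Y (1 / real (Suc k)) - 1)"
      unfolding d_def mgf_def using int1 intk[of k] by (simp add: prob_space del: of_nat_Suc)
    also have "\<dots> \<le> mgf M Y 1 - 1" using no[of "1 / real (Suc k)"] by simp
    finally show ?thesis by (simp add: ennreal_leI)
  qed
  have "(\<integral>\<^sup>+\<omega>. ennreal (exp (Y \<omega>) - 1 - Y \<omega>) \<partial>M) = (\<integral>\<^sup>+\<omega>. liminf (\<lambda>k. ennreal (d k (Y \<omega>))) \<partial>M)"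
    by (intro nn_integral_cong) (metis lim lim_imp_Liminf sequentially_bot tendsto_ennrealI)
  also have "\<dots> \<le> liminf (\<lambda>k. \<integral>\<^sup>+\<omega>. ennreal (d k (Y \<omega>)) \<partial>M)"
    by (intro nn_integral_liminf) (auto simp: d_def)
  also have "\<dots> \<le> limsup (\<lambda>k. \<integral>\<^sup>+\<omega>. ennreal (d k (Y \<omega>)) \<partial>M)"
    by (intro Liminf_le_Limsup) auto
  also have "\<dots> \<le> ennreal (mgf M Y 1 - 1)"
    using nnk by (intro Limsup_bounded) auto
  finally have le: "(\<integral>\<^sup>+\<omega>. ennreal (exp (Y \<omega>) - 1 - Y \<omega>) \<partial>M) \<le> ennreal (mgf M Y 1 - 1)" .
  have nn: "exp y - 1 - y \<ge> 0" for y :: real using exp_ge_add_one_self[of y] by linarith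
  have i: "integrable M (\<lambda>\<omega>. exp (Y \<omega>) - 1 - Y \<omega>)"
    using le nn by (intro integrableI_nonneg) (auto simp: top.extremum_strict intro: le_less_trans)
  have iY: "integrable M Y"
    using Bochner_Integration.integrable_diff[OF Bochner_Integration.integrable_diff[OF int1 integrable_const[of 1]] i] by simp
  have "(\<integral>\<omega>. exp (Y \<omega>) - 1 - Y \<omega> \<partial>M) \<le> mgf M Y 1 - 1"
    using le no[of 1] by (intro integral_real_bounded) auto
  then have "expectation Y \<ge> 0" using int1 iY by (simp add: mgf_def prob_space)
  then show False using neg ext_mean_eq_expectation[OF iY] by simp
qed

text \<open>
Convexity of \<open>\<phi>\<close> on an interval \<open>[0, s\<^sub>0]\<close> with \<open>\<phi>(0) = 1\<close> and \<open>\<phi>(s\<^sub>0) < 1\<close>.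
\<close>

lemma (in prob_space) mgf_linear_bound:
  fixes Y :: "'a \<Rightarrow> real"
  assumes rv [measurable]: "random_variable borel Y" and neg: "ext_mean M Y < 0"
    and int: "\<And>s. s \<ge> 0 \<Longrightarrow> integrable M (\<lambda>\<omega>. exp (s * Y \<omega>))"
  obtains s0 c where "s0 > 0" "c > 0" "\<And>s. 0 \<le> s \<Longrightarrow> s \<le> s0 \<Longrightarrow> mgf M Y s \<le> exp (- c * s)"
proof -
  obtain s0 where s0: "s0 > 0" "mgf M Y s0 < 1"
    using negative_mean_imp_mgf_less_1[OF rv neg int] by blast
  define c where "c = (1 - mgf M Y s0) / s0"
  have "mgf M Y s \<le> exp (- c * s)" if s: "0 \<le> s" "s \<le> s0" for s
  proof -
    define r where "r = s / s0"
    have r: "0 \<le> r" "r \<le> 1" "s = r * s0" using s s0 by (auto simp: r_def)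
    have pt: "exp (s * y) \<le> (1 - r) + r * exp (s0 * y)" for y
      using convex_onD[OF exp_convex r(1,2), of 0 "s0 * y"] r by (simp add: mult_ac)
    have "mgf M Y s \<le> (\<integral>\<omega>. (1 - r) + r * exp (s0 * Y \<omega>) \<partial>M)"
      unfolding mgf_def using int[of s] int[of s0] s s0 pt by (intro integral_mono) auto
    also have "\<dots> = 1 + (- c * s)"
      using int[of s0] s0 by (simp add: mgf_def prob_space c_def r_def field_simps)
    also have "\<dots> \<le> exp (- c * s)" by (rule exp_ge_add_one_self)
    finally show ?thesis .
  qed
  moreover have "c > 0" using s0 by (simp add: c_def)
  ultimately show ?thesis using that s0(1) by blast
qed

section \<open>The moment generating function at infinity and the Legendre transform\<close>

text \<open>
If \<open>h\<close> is continuous, \<open>h(Y)\<close> is a standard exponential variable, so that \<open>exp (a h(Y))\<close> is integrable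
for \<open>a < 1\<close>. When \<open>h\<close> has jumps, \<open>h(Y)\<close> may have a heavier tail. Shrinking the argument by a factor
\<open>\<rho> < 1\<close> restores the bound \<open>P(h(\<rho> Y) \<ge> k) \<le> exp (- k)\<close> on the event \<open>Y \<ge> 1\<close>.
\<close>

lemma (in prob_space) tail_transform_bound:
  fixes Y :: "'a \<Rightarrow> real" and h :: "real \<Rightarrow> real"
  assumes rv [measurable]: "random_variable borel Y"
    and tail: "\<And>x. prob {\<omega> \<in> space M. x < Y \<omega>} = exp (- h x)"
    and mono: "mono h" and rho: "0 < \<rho>" "\<rho> < 1" and a: "0 \<le> a" "a < 1"
  shows "(\<integral>\<^sup>+\<omega>. ennreal (exp (a * h (\<rho> * Y \<omega>)) * indicator {1..} (Y \<omega>)) \<partial>M)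
      \<le> ennreal (exp a / (1 - exp (a - 1)))"
proof -
  have [measurable]: "h \<in> borel_measurable borel" using mono by (rule borel_measurable_mono)
  have h0: "h x \<ge> 0" for x using tail[of x] prob_le_1[of "{\<omega> \<in> space M. x < Y \<omega>}"] by simp
  define A where "A k = {\<omega> \<in> space M. 1 \<le> Y \<omega> \<and> real k \<le> h (\<rho> * Y \<omega>)}" for k :: nat
  have [measurable]: "A k \<in> sets M" for k unfolding A_def by measurable
  have PA: "prob (A k) \<le> exp (- real k)" for k
  proof (cases "A k = {}")
    case False
    define S where "S = {x. 1 \<le> x \<and> real k \<le> h (\<rho> * x)}"
    have Sne: "S \<noteq> {}" using False by (auto simp: S_def A_def)
    have Sb: "bdd_below S" by (auto simp: S_def intro: bdd_belowI[of _ 1])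
    have I1: "Inf S \<ge> 1" using Sne by (intro cInf_greatest) (auto simp: S_def)
    \<comment> \<open>The factor \<open>\<rho>\<close> makes room for a point of \<open>S\<close> whose image under \<open>\<rho>\<close> lies strictly below \<open>S\<close>.\<close>
    have "Inf S < Inf S / \<rho>" using I1 rho by (simp add: field_simps)
    then obtain x0 where x0: "x0 \<in> S" "x0 < Inf S / \<rho>" using cInf_lessD[OF Sne] by blast
    have "\<rho> * x0 < Inf S" using x0(2) rho by (simp add: field_simps)
    then have "A k \<subseteq> {\<omega> \<in> space M. \<rho> * x0 < Y \<omega>}"
      using cInf_lower[OF _ Sb] by (fastforce simp: A_def S_def)
    then have "prob (A k) \<le> exp (- h (\<rho> * x0))"
      unfolding tail[symmetric] by (intro finite_measure_mono) auto
    also have "\<dots> \<le> exp (- real k)" using x0(1) by (simp add: S_def)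
    finally show ?thesis .
  qed simp
  have pt: "ennreal (exp (a * h (\<rho> * Y \<omega>)) * indicator {1..} (Y \<omega>))
      \<le> (\<Sum>k. ennreal (exp (a * (real k + 1))) * indicator (A k) \<omega>)" if "\<omega> \<in> space M" for \<omega>
  proof (cases "1 \<le> Y \<omega>")
    case True
    \<comment> \<open>One term of the series, with \<open>k\<close> the integer part of \<open>h (\<rho> Y)\<close>, already dominates.\<close>
    define k where "k = nat \<lfloor>h (\<rho> * Y \<omega>)\<rfloor>"
    have k: "real k \<le> h (\<rho> * Y \<omega>)" "h (\<rho> * Y \<omega>) \<le> real k + 1"
      unfolding k_def using h0[of "\<rho> * Y \<omega>"] by linarith+
    have "ennreal (exp (a * h (\<rho> * Y \<omega>)) * indicator {1..} (Y \<omega>)) \<le> ennreal (exp (a * (real k + 1)))"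
      using True k a by (auto intro!: ennreal_leI mult_left_mono)
    also have "\<dots> = (\<Sum>j\<in>{k}. ennreal (exp (a * (real j + 1))) * indicator (A j) \<omega>)"
      using True k that by (simp add: A_def)
    also have "\<dots> \<le> (\<Sum>k. ennreal (exp (a * (real k + 1))) * indicator (A k) \<omega>)"
      by (intro sum_le_suminf) auto
    finally show ?thesis .
  qed simp
  have "(\<integral>\<^sup>+\<omega>. ennreal (exp (a * h (\<rho> * Y \<omega>)) * indicator {1..} (Y \<omega>)) \<partial>M)
     \<le> (\<integral>\<^sup>+\<omega>. (\<Sum>k. ennreal (exp (a * (real k + 1))) * indicator (A k) \<omega>) \<partial>M)"
    by (intro nn_integral_mono pt)
  also have "\<dots> = (\<Sum>k. \<integral>\<^sup>+\<omega>. ennreal (exp (a * (real k + 1))) * indicator (A k) \<omega> \<partial>M)"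
    by (intro nn_integral_suminf) auto
  also have "\<dots> = (\<Sum>k. ennreal (exp (a * (real k + 1)) * prob (A k)))"
    by (simp add: nn_integral_cmult emeasure_eq_measure ennreal_mult')
  also have "\<dots> \<le> (\<Sum>k. ennreal (exp a * exp (a - 1) ^ k))"
  proof (intro suminf_le ennreal_leI)
    fix k
    have "exp (a * (real k + 1)) * prob (A k) \<le> exp (a * (real k + 1)) * exp (- real k)"
      using PA by (intro mult_left_mono) auto
    also have "\<dots> = exp a * exp (a - 1) ^ k"
      by (simp add: exp_of_nat_mult[symmetric] exp_add[symmetric] algebra_simps)
    finally show "exp (a * (real k + 1)) * prob (A k) \<le> exp a * exp (a - 1) ^ k" .
  qed auto
  also have "\<dots> = ennreal (exp a / (1 - exp (a - 1)))"
  proof (intro suminf_ennreal_eq)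
    show "(\<lambda>k. exp a * exp (a - 1) ^ k) sums (exp a / (1 - exp (a - 1)))"
      using sums_mult[OF geometric_sums[of "exp (a - 1)"], of "exp a"] a by simp
  qed auto
  finally show ?thesis .
qed

text \<open>
On \<open>Y > L\<close>, the integrand is \<open>exp (l Y - a h(\<rho> Y)) exp (a h(\<rho> Y))\<close>. The first factor is at most \<open>exp D\<close>
and the second one is integrable by \<open>tail_transform_bound\<close>. Hence \<open>log \<phi>\<close> is bounded, up to
additive terms, by the Legendre transform of \<open>x \<mapsto> a h(\<rho> x)\<close>.
\<close>

lemma (in prob_space) mgf_le_legendre:
  fixes Y :: "'a \<Rightarrow> real" and h :: "real \<Rightarrow> real"
  assumes rv [measurable]: "random_variable borel Y"
    and tail: "\<And>x. prob {\<omega> \<in> space M. x < Y \<omega>} = exp (- h x)"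
    and mono: "mono h" and rho: "0 < \<rho>" "\<rho> < 1" and a: "0 \<le> a" "a < 1"
    and l: "l \<ge> 0" and L: "L \<ge> 1" and D: "D \<ge> 0"
    and le: "\<And>x. x \<ge> L \<Longrightarrow> l * x - a * h (\<rho> * x) \<le> D"
  shows "mgf M Y l \<le> (1 + exp a / (1 - exp (a - 1))) * exp (l * L + D)"
proof -
  have [measurable]: "h \<in> borel_measurable borel" using mono by (rule borel_measurable_mono)
  define C where "C = exp a / (1 - exp (a - 1))"
  have C: "C \<ge> 0" using a by (simp add: C_def)
  have "(\<integral>\<^sup>+\<omega>. ennreal (exp (l * Y \<omega>)) \<partial>M)
     \<le> (\<integral>\<^sup>+\<omega>. ennreal (exp (l * L)) + ennreal (exp D) * ennreal (exp (a * h (\<rho> * Y \<omega>)) * indicator {1..} (Y \<omega>)) \<partial>M)"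
  proof (intro nn_integral_mono)
    fix \<omega>
    show "ennreal (exp (l * Y \<omega>)) \<le> ennreal (exp (l * L)) + ennreal (exp D) * ennreal (exp (a * h (\<rho> * Y \<omega>)) * indicator {1..} (Y \<omega>))"
    proof (cases "Y \<omega> \<le> L")
      case True
      then have "ennreal (exp (l * Y \<omega>)) \<le> ennreal (exp (l * L))" using l by (simp add: mult_left_mono)
      then show ?thesis by (rule order_trans) simp
    next
      case False
      then have "exp (l * Y \<omega>) \<le> exp (D + a * h (\<rho> * Y \<omega>))" using le[of "Y \<omega>"] by simp
      also have "\<dots> = exp D * (exp (a * h (\<rho> * Y \<omega>)) * indicator {1..} (Y \<omega>))"
        using False L by (simp add: exp_add)
      finally have "ennreal (exp (l * Y \<omega>)) \<le> ennreal (exp D) * ennreal (exp (a * h (\<rho> * Y \<omega>)) * indicator {1..} (Y \<omega>))"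
        by (subst ennreal_mult[symmetric]) (auto intro: ennreal_leI)
      then show ?thesis by (rule order_trans) simp
    qed
  qed
  also have "\<dots> = ennreal (exp (l * L)) + ennreal (exp D) * (\<integral>\<^sup>+\<omega>. ennreal (exp (a * h (\<rho> * Y \<omega>)) * indicator {1..} (Y \<omega>)) \<partial>M)"
    by (simp add: nn_integral_add nn_integral_cmult emeasure_space_1)
  also have "\<dots> \<le> ennreal (exp (l * L)) + ennreal (exp D) * ennreal C"
    unfolding C_def by (intro add_left_mono mult_left_mono tail_transform_bound[OF rv tail mono rho a]) auto
  also have "\<dots> = ennreal (exp (l * L) + exp D * C)" using C by (simp add: ennreal_mult ennreal_plus)
  also have "\<dots> \<le> ennreal ((1 + C) * exp (l * L + D))"
  proof (intro ennreal_leI)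
    have lL: "l * L \<ge> 0" using l L by simp
    have "exp (l * L) \<le> exp (l * L + D)" using D by simp
    moreover have "C * exp D \<le> C * exp (l * L + D)" using C lL by (intro mult_left_mono) auto
    ultimately have "exp (l * L) + C * exp D \<le> exp (l * L + D) + C * exp (l * L + D)" by (rule add_mono)
    then show "exp (l * L) + exp D * C \<le> (1 + C) * exp (l * L + D)"
      by (simp only: distrib_right mult_1 mult.commute[of "exp D" C])
  qed
  finally show ?thesis unfolding mgf_def C_def[symmetric] using C by (intro integral_real_bounded) auto
qed

text \<open>
The Legendre transform \<open>sup\<^sub>w (v w - b w\<^sup>p)\<close> of a power. The exponent \<open>p / (p - 1)\<close> is conjugate to \<open>p\<close>.
\<close>

definition legendre_power :: "real \<Rightarrow> real \<Rightarrow> real \<Rightarrow> real" where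
  "legendre_power p b v = v powr (p / (p - 1)) / (p / (p - 1) * (p * b) powr (1 / (p - 1)))"

text \<open>
Young's inequality for the product of \<open>(p b)\<^bsup>1/p\<^esup> w\<close> and \<open>v / (p b)\<^bsup>1/p\<^esup>\<close>.
\<close>

lemma legendre_power_bound:
  assumes "p > 1" "b > 0" "v \<ge> 0" "w \<ge> 0"
  shows "v * w - b * w powr p \<le> legendre_power p b v"
proof -
  define q where "q = p / (p - 1)"
  have q: "q > 1" "1 / p + 1 / q = 1" "q / p = 1 / (p - 1)" using assms by (auto simp: q_def field_simps)
  define k where "k = (p * b) powr (1 / p)"
  have k: "k > 0" "k powr p = p * b" "k powr q = (p * b) powr (1 / (p - 1))"
    using assms q(3) by (auto simp: k_def powr_powr)
  have "(k * w) * (v / k) \<le> (k * w) powr p / p + (v / k) powr q / q"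
    by (rule Youngs_inequality) (use assms q k in auto)
  also have "(k * w) powr p / p = b * w powr p"
    using assms k by (simp add: powr_mult)
  also have "(v / k) powr q / q = legendre_power p b v"
    using assms k q by (simp add: powr_divide legendre_power_def q_def[symmetric])
  finally show ?thesis using k by (simp add: mult.commute)
qed

lemma legendre_power_nonneg: "p > 1 \<Longrightarrow> legendre_power p b v \<ge> 0"
  by (simp add: legendre_power_def)

text \<open>
Potter's bounds compare \<open>h(w t) / h(t)\<close> with \<open>w\<^bsup>\<alpha>-\<eta>\<^esup>\<close> for \<open>w \<ge> 1\<close> and with \<open>w\<^bsup>\<alpha>+\<eta>\<^esup>\<close> for \<open>w \<le> 1\<close>; hence the maximum
of two Legendre transforms. The parameter \<open>\<eta>\<close> also serves as the loss in each of the three factors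
close to \<open>1\<close>: the factor \<open>\<rho>\<close> on the argument, the factor \<open>a\<close> in the exponent, and Potter's constant.
\<close>

definition legendre_envelope :: "real \<Rightarrow> real \<Rightarrow> real \<Rightarrow> real" where
  "legendre_envelope \<alpha> \<eta> u = max (legendre_power (\<alpha> - \<eta>) ((1 - \<eta>)\<^sup>2) (u / (1 - \<eta>)))
     (legendre_power (\<alpha> + \<eta>) ((1 - \<eta>)\<^sup>2) (u / (1 - \<eta>)))"

text \<open>
In the variable \<open>w = (1 - \<eta>) x / t\<close> the left-hand side is \<open>h(t)\<close> times
\<open>u w / (1 - \<eta>) - (1 - \<eta>) h(w t) / h(t)\<close>, and Potter's bounds apply because both \<open>t\<close> and \<open>w t\<close> are at least
\<open>T\<close>.
\<close>

lemma legendre_of_regularly_varying_le: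
  fixes h :: "real \<Rightarrow> real"
  assumes \<eta>: "0 < \<eta>" "\<eta> < 1" "\<eta> < \<alpha> - 1" and T: "T > 0" "\<And>t. t \<ge> T \<Longrightarrow> 0 < h t"
    and lower: "\<And>t y. t \<ge> T \<Longrightarrow> y \<ge> 1 \<Longrightarrow> (1 - \<eta>) * y powr (\<alpha> - \<eta>) * h t \<le> h (y * t)"
    and upper: "\<And>t y. t \<ge> T \<Longrightarrow> y \<ge> 1 \<Longrightarrow> h (y * t) \<le> (1 + \<eta>) * y powr (\<alpha> + \<eta>) * h t"
    and t: "t \<ge> T" and x: "(1 - \<eta>) * x \<ge> T" and u: "u \<ge> 0"
  shows "u * h t / t * x - (1 - \<eta>) * h ((1 - \<eta>) * x) \<le> h t * legendre_envelope \<alpha> \<eta> u"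
proof -
  define w where "w = (1 - \<eta>) * x / t"
  define v where "v = u / (1 - \<eta>)"
  have t0: "t > 0" "h t > 0" using t T by auto
  have w0: "w > 0" using x T t0 by (simp add: w_def)
  have wt: "w * t = (1 - \<eta>) * x" using t0 by (simp add: w_def)
  have v0: "v \<ge> 0" using u \<eta> by (simp add: v_def)
  have e1: "u * h t / t * x = h t * (v * w)" using \<eta> t0 by (simp add: v_def w_def)
  have key: "(1 - \<eta>) * h (w * t) \<ge> (1 - \<eta>)\<^sup>2 * w powr p * h t \<Longrightarrow> p > 1 \<Longrightarrow>
     u * h t / t * x - (1 - \<eta>) * h ((1 - \<eta>) * x) \<le> h t * legendre_power p ((1 - \<eta>)\<^sup>2) v" for p
  proof -
    assume a: "(1 - \<eta>) * h (w * t) \<ge> (1 - \<eta>)\<^sup>2 * w powr p * h t" "p > 1"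
    have "u * h t / t * x - (1 - \<eta>) * h ((1 - \<eta>) * x) \<le> h t * (v * w - (1 - \<eta>)\<^sup>2 * w powr p)"
      using a unfolding e1 wt[symmetric] by (simp add: algebra_simps)
    also have "\<dots> \<le> h t * legendre_power p ((1 - \<eta>)\<^sup>2) v"
      using a \<eta> v0 w0 t0 by (intro mult_left_mono legendre_power_bound) auto
    finally show ?thesis .
  qed
  show ?thesis
  proof (cases "w \<ge> 1")
    case True
    have "(1 - \<eta>) * ((1 - \<eta>) * w powr (\<alpha> - \<eta>) * h t) \<le> (1 - \<eta>) * h (w * t)"
      using lower[OF t True] \<eta> by (intro mult_left_mono) auto
    then have "u * h t / t * x - (1 - \<eta>) * h ((1 - \<eta>) * x) \<le> h t * legendre_power (\<alpha> - \<eta>) ((1 - \<eta>)\<^sup>2) v"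
      using \<eta> by (intro key) (auto simp: power2_eq_square mult_ac)
    also have "\<dots> \<le> h t * legendre_envelope \<alpha> \<eta> u"
      unfolding legendre_envelope_def v_def using t0 by (intro mult_left_mono) auto
    finally show ?thesis .
  next
    case False
    have "h (1 / w * (w * t)) \<le> (1 + \<eta>) * (1 / w) powr (\<alpha> + \<eta>) * h (w * t)"
      using upper[of "w * t" "1 / w"] False w0 x wt by simp
    then have "w powr (\<alpha> + \<eta>) * h t \<le> (1 + \<eta>) * h (w * t)"
      using w0 by (simp add: powr_divide field_simps)
    then have "(1 - \<eta>) * (w powr (\<alpha> + \<eta>) * h t) \<le> (1 - \<eta>) * ((1 + \<eta>) * h (w * t))"
      using \<eta> by (intro mult_left_mono) auto
    also have "\<dots> = (1 - \<eta>\<^sup>2) * h (w * t)" by (simp add: algebra_simps power2_eq_square)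
    also have "\<dots> \<le> 1 * h (w * t)" using T(2)[of "w * t"] x wt by (intro mult_right_mono) auto
    finally have "(1 - \<eta>) * ((1 - \<eta>) * (w powr (\<alpha> + \<eta>) * h t)) \<le> (1 - \<eta>) * h (w * t)"
      using \<eta> by (intro mult_left_mono) auto
    then have "u * h t / t * x - (1 - \<eta>) * h ((1 - \<eta>) * x) \<le> h t * legendre_power (\<alpha> + \<eta>) ((1 - \<eta>)\<^sup>2) v"
      using \<eta> by (intro key) (auto simp: power2_eq_square mult_ac)
    also have "\<dots> \<le> h t * legendre_envelope \<alpha> \<eta> u"
      unfolding legendre_envelope_def v_def using t0 by (intro mult_left_mono) auto
    finally show ?thesis .
  qed
qed

lemma legendre_envelope_nonneg: "0 < \<eta> \<Longrightarrow> \<eta> < \<alpha> - 1 \<Longrightarrow> legendre_envelope \<alpha> \<eta> u \<ge> 0"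
  using legendre_power_nonneg[of "\<alpha> - \<eta>"] by (simp add: legendre_envelope_def le_max_iff_disj)

lemma (in prob_space) mgf_le_envelope:
  fixes Y :: "'a \<Rightarrow> real" and h :: "real \<Rightarrow> real"
  assumes Y: "random_variable borel Y"
    and tail: "\<And>x. prob {\<omega> \<in> space M. x < Y \<omega>} = exp (- h x)" and mono: "mono h"
    and rv: "regularly_varying_at_infinity h \<alpha>"
    and \<eta>: "0 < \<eta>" "\<eta> < 1" "\<eta> < \<alpha> - 1"
  obtains C L T where "C \<ge> 0" "L \<ge> 0" "T > 0"
    "\<And>t u. t \<ge> T \<Longrightarrow> u \<ge> 0 \<Longrightarrow>
       mgf M Y (u * h t / t) \<le> exp (C + u * h t / t * L + h t * legendre_envelope \<alpha> \<eta> u)"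
proof -
  have h0: "h x \<ge> 0" for x using tail[of x] prob_le_1[of "{\<omega> \<in> space M. x < Y \<omega>}"] by simp
  obtain T where T: "T \<ge> 0" "T > 0" "\<And>t. t \<ge> T \<Longrightarrow> 0 < h t"
    "\<And>t y. t \<ge> T \<Longrightarrow> y \<ge> 1 \<Longrightarrow> (1 - \<eta>) * y powr (\<alpha> - \<eta>) * h t \<le> h (y * t)"
    "\<And>t y. t \<ge> T \<Longrightarrow> y \<ge> 1 \<Longrightarrow> h (y * t) \<le> (1 + \<eta>) * y powr (\<alpha> + \<eta>) * h t"
    using potter_bounds[of 0 h \<alpha> \<eta>] monoD[OF mono] h0 rv \<eta> by (smt (verit))
  define L where "L = max 1 (T / (1 - \<eta>))"
  define A where "A = 1 + exp (1 - \<eta>) / (1 - exp ((1 - \<eta>) - 1))"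
  have A: "A \<ge> 1" using \<eta> by (simp add: A_def)
  show ?thesis
  proof (rule that[of "ln A" L T])
    fix t u :: real assume t: "t \<ge> T" and u: "u \<ge> 0"
    have "mgf M Y (u * h t / t) \<le> A * exp (u * h t / t * L + h t * legendre_envelope \<alpha> \<eta> u)"
      unfolding A_def
    proof (rule mgf_le_legendre[OF Y tail mono, of "1 - \<eta>"])
      fix x assume "L \<le> x"
      then have "T / (1 - \<eta>) \<le> x" by (simp add: L_def)
      then have "(1 - \<eta>) * x \<ge> T" using \<eta> by (simp add: field_simps)
      then show "u * h t / t * x - (1 - \<eta>) * h ((1 - \<eta>) * x) \<le> h t * legendre_envelope \<alpha> \<eta> u"
        using legendre_of_regularly_varying_le[of \<eta> \<alpha> T h t x u] \<eta> T t u by blast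
    qed (use \<eta> u t T(2) h0 legendre_envelope_nonneg in \<open>auto simp: L_def\<close>)
    also have "\<dots> = exp (ln A + u * h t / t * L + h t * legendre_envelope \<alpha> \<eta> u)"
      using A by (simp add: exp_add)
    finally show "mgf M Y (u * h t / t) \<le> exp (ln A + u * h t / t * L + h t * legendre_envelope \<alpha> \<eta> u)" .
  qed (use A T in \<open>auto simp: L_def\<close>)
qed

lemma legendre_envelope_tendsto:
  assumes "\<alpha> > 1" "u > 0"
  shows "((\<lambda>\<eta>. legendre_envelope \<alpha> \<eta> u) \<longlongrightarrow> legendre_power \<alpha> 1 u) (at_right 0)"
proof -
  have id: "((\<lambda>\<eta>. \<eta>) \<longlongrightarrow> 0) (at_right (0::real))" by (rule tendsto_ident_at)
  have "((\<lambda>\<eta>. legendre_envelope \<alpha> \<eta> u) \<longlongrightarrow>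
      max (legendre_power (\<alpha> - 0) ((1 - 0)\<^sup>2) (u / (1 - 0))) (legendre_power (\<alpha> + 0) ((1 - 0)\<^sup>2) (u / (1 - 0)))) (at_right 0)"
    unfolding legendre_envelope_def legendre_power_def
    by (intro tendsto_intros id) (use assms in auto)
  then show ?thesis by simp
qed

text \<open>
For fixed \<open>\<eta>\<close>, the additive terms \<open>C + L u h(t) / t\<close> of \<open>mgf_le_envelope\<close> are negligible compared with
\<open>h(t)\<close>; then \<open>\<eta>\<close> tends to \<open>0\<close>.
\<close>

lemma (in prob_space) log_mgf_limsup:
  fixes Y :: "'a \<Rightarrow> real" and h :: "real \<Rightarrow> real"
  assumes Y: "random_variable borel Y"
    and tail: "\<And>x. prob {\<omega> \<in> space M. x < Y \<omega>} = exp (- h x)" and mono: "mono h"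
    and rv: "regularly_varying_at_infinity h \<alpha>" and \<alpha>: "\<alpha> > 1"
    and h_top: "filterlim h at_top at_top"
    and u: "u \<ge> 0" and \<delta>: "\<delta> > 0"
  shows "\<forall>\<^sub>F t in at_top. mgf M Y (u * h t / t) \<le> exp (h t * (legendre_power \<alpha> 1 u + \<delta>))"
proof (cases "u = 0")
  case True
  have "0 \<le> h t" for t using tail[of t] prob_le_1[of "{\<omega> \<in> space M. t < Y \<omega>}"] by simp
  then show ?thesis using True \<delta> legendre_power_nonneg[OF \<alpha>, of 1 0] by (simp add: mgf_def prob_space)
next
  case False
  then have u0: "u > 0" using u by simp
  have "\<forall>\<^sub>F \<eta> in at_right 0. legendre_envelope \<alpha> \<eta> u < legendre_power \<alpha> 1 u + \<delta> / 2"
    by (rule order_tendstoD[OF legendre_envelope_tendsto[OF \<alpha> u0]]) (use \<delta> in auto)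
  moreover have "\<forall>\<^sub>F \<eta> in at_right 0. \<eta> < min 1 (\<alpha> - 1) \<and> \<eta> > 0"
    unfolding eventually_at_right_field using \<alpha> by (intro exI[of _ "min 1 (\<alpha> - 1)"]) auto
  ultimately have "\<forall>\<^sub>F \<eta> in at_right 0. legendre_envelope \<alpha> \<eta> u < legendre_power \<alpha> 1 u + \<delta> / 2 \<and>
     \<eta> < min 1 (\<alpha> - 1) \<and> \<eta> > 0" by eventually_elim auto
  then obtain \<eta> where \<eta>: "legendre_envelope \<alpha> \<eta> u < legendre_power \<alpha> 1 u + \<delta> / 2"
     "\<eta> < 1" "\<eta> < \<alpha> - 1" "\<eta> > 0"
    using eventually_happens'[OF trivial_limit_at_right_real] by fastforce
  obtain C L T where CL: "C \<ge> 0" "L \<ge> 0" "T > 0"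
    "\<And>t u. t \<ge> T \<Longrightarrow> u \<ge> 0 \<Longrightarrow>
       mgf M Y (u * h t / t) \<le> exp (C + u * h t / t * L + h t * legendre_envelope \<alpha> \<eta> u)"
    using mgf_le_envelope[OF Y tail mono rv \<eta>(4,2,3)] by metis
  have "\<forall>\<^sub>F t in at_top. h t \<ge> 4 * C / \<delta>" using h_top by (simp add: filterlim_at_top)
  moreover have "\<forall>\<^sub>F t in at_top. t \<ge> max T (4 * u * L / \<delta>)" by (rule eventually_ge_at_top)
  ultimately show ?thesis
  proof eventually_elim
    case (elim t)
    have t: "t \<ge> T" "t > 0" using elim CL(3) by auto
    have h0: "h t \<ge> 0" using tail[of t] prob_le_1[of "{\<omega> \<in> space M. t < Y \<omega>}"] by simp
    have "C \<le> h t * (\<delta> / 4)" using elim(1) \<delta> by (simp add: field_simps)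
    moreover have "u / t * L \<le> \<delta> / 4" using elim(2) \<delta> t by (simp add: field_simps)
    then have "h t * (u / t * L) \<le> h t * (\<delta> / 4)" using h0 by (intro mult_left_mono)
    moreover have "h t * legendre_envelope \<alpha> \<eta> u \<le> h t * (legendre_power \<alpha> 1 u + \<delta> / 2)"
      using h0 \<eta>(1) by (intro mult_left_mono) auto
    moreover have "u * h t / t * L = h t * (u / t * L)" by simp
    moreover have "h t * (\<delta> / 4) + h t * (\<delta> / 4) + h t * (legendre_power \<alpha> 1 u + \<delta> / 2)
        = h t * (legendre_power \<alpha> 1 u + \<delta>)" by (simp add: algebra_simps)
    ultimately have "C + u * h t / t * L + h t * legendre_envelope \<alpha> \<eta> u \<le> h t * (legendre_power \<alpha> 1 u + \<delta>)"
      by linarith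
    then show ?case using CL(4)[OF t(1) u] by (meson exp_le_cancel_iff order_trans)
  qed
qed

text \<open>
For \<open>u\<close> in a bounded interval the smaller of the two conjugate exponents, that of \<open>\<alpha> + \<eta>\<close>, dominates.
\<close>

lemma legendre_envelope_le_powr:
  assumes \<eta>: "0 < \<eta>" "\<eta> < 1" "\<eta> < \<alpha> - 1"
  obtains C where "C \<ge> 0"
    "\<And>u. 0 \<le> u \<Longrightarrow> u \<le> U \<Longrightarrow> legendre_envelope \<alpha> \<eta> u \<le> C * u powr ((\<alpha> + \<eta>) / (\<alpha> + \<eta> - 1))"
proof -
  define q where "q = (\<alpha> + \<eta>) / (\<alpha> + \<eta> - 1)"
  define q' where "q' = (\<alpha> - \<eta>) / (\<alpha> - \<eta> - 1)"
  have qq: "q \<le> q'" using \<eta> by (simp add: q_def q'_def field_simps)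
  define k where "k p = (1 - \<eta>) powr (p / (p - 1)) * (p / (p - 1) * (p * (1 - \<eta>)\<^sup>2) powr (1 / (p - 1)))" for p
  have k0: "k (\<alpha> - \<eta>) > 0" "k (\<alpha> + \<eta>) > 0" using \<eta> by (auto simp: k_def)
  have lp: "legendre_power p ((1 - \<eta>)\<^sup>2) (u / (1 - \<eta>)) = u powr (p / (p - 1)) / k p" if "u \<ge> 0" for p u
    using \<eta> that by (simp add: legendre_power_def k_def powr_divide)
  define C where "C = U powr (q' - q) / k (\<alpha> - \<eta>) + 1 / k (\<alpha> + \<eta>)"
  have "legendre_envelope \<alpha> \<eta> u \<le> C * u powr q" if u: "0 \<le> u" "u \<le> U" for u
  proof -
    have "u powr q' = u powr q * u powr (q' - q)" by (simp add: powr_add[symmetric])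
    also have "\<dots> \<le> u powr q * U powr (q' - q)"
      using u qq by (intro mult_left_mono powr_mono2) auto
    finally have 1: "u powr q' / k (\<alpha> - \<eta>) \<le> u powr q * (U powr (q' - q) / k (\<alpha> - \<eta>))"
      using k0 by (simp add: divide_right_mono)
    have 2: "0 \<le> u powr q * (U powr (q' - q) / k (\<alpha> - \<eta>))" "0 \<le> u powr q / k (\<alpha> + \<eta>)" using k0 by auto
    have "legendre_envelope \<alpha> \<eta> u = max (u powr q' / k (\<alpha> - \<eta>)) (u powr q / k (\<alpha> + \<eta>))"
      unfolding legendre_envelope_def lp[OF u(1)] q_def q'_def ..
    also have "\<dots> \<le> u powr q * (U powr (q' - q) / k (\<alpha> - \<eta>)) + u powr q / k (\<alpha> + \<eta>)"
      using 1 2 by linarith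
    finally show ?thesis by (simp add: C_def algebra_simps)
  qed
  moreover have "C \<ge> 0" using k0 by (simp add: C_def)
  ultimately show ?thesis using that unfolding q_def by blast
qed

text \<open>
This plays the role of the dominating function when the bounds of \<open>log_mgf_limsup\<close> are summed over the
coefficients. The additive terms of \<open>mgf_le_envelope\<close> are not small compared with \<open>h(t) u\<^sup>q\<close> when \<open>u\<close> tends
to \<open>0\<close> along with \<open>1 / t\<close>. But if the argument \<open>u h(t) / t\<close> is at most \<open>s\<^sub>0\<close>, there is nothing to bound, and otherwise
\<open>u \<ge> s\<^sub>0 t / h(t)\<close> is bounded below by a multiple of \<open>t\<^bsup>1-\<alpha>-\<eta>\<^esup>\<close>. As \<open>q\<close> is conjugate to \<open>\<alpha> + \<eta>\<close>, this is
exactly what absorbs those terms.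
\<close>

lemma (in prob_space) log_mgf_dominated:
  fixes Y :: "'a \<Rightarrow> real" and h :: "real \<Rightarrow> real"
  assumes Y: "random_variable borel Y"
    and tail: "\<And>x. prob {\<omega> \<in> space M. x < Y \<omega>} = exp (- h x)" and mono: "mono h"
    and rv: "regularly_varying_at_infinity h \<alpha>"
    and \<eta>: "0 < \<eta>" "\<eta> < 1" "\<eta> < \<alpha> - 1"
    and s0: "s0 > 0" and small: "\<And>s. 0 \<le> s \<Longrightarrow> s \<le> s0 \<Longrightarrow> mgf M Y s \<le> 1"
  obtains C where "C \<ge> 0"
    "\<forall>\<^sub>F t in at_top. \<forall>u. 0 \<le> u \<and> u \<le> U \<longrightarrow>
       mgf M Y (u * h t / t) \<le> exp (h t * (C * u powr ((\<alpha> + \<eta>) / (\<alpha> + \<eta> - 1))))"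
proof -
  define q where "q = (\<alpha> + \<eta>) / (\<alpha> + \<eta> - 1)"
  have q: "q - 1 = 1 / (\<alpha> + \<eta> - 1)" "q > 1" using \<eta> by (auto simp: q_def field_simps)
  have h0: "h x \<ge> 0" for x using tail[of x] prob_le_1[of "{\<omega> \<in> space M. x < Y \<omega>}"] by simp
  obtain C1 where C1: "C1 \<ge> 0"
    "\<And>u. 0 \<le> u \<Longrightarrow> u \<le> U \<Longrightarrow> legendre_envelope \<alpha> \<eta> u \<le> C1 * u powr q"
    using legendre_envelope_le_powr[OF \<eta>, of U] unfolding q_def by metis
  obtain C0 L T where CL: "C0 \<ge> 0" "L \<ge> 0" "T > 0"
    "\<And>t u. t \<ge> T \<Longrightarrow> u \<ge> 0 \<Longrightarrow>
       mgf M Y (u * h t / t) \<le> exp (C0 + u * h t / t * L + h t * legendre_envelope \<alpha> \<eta> u)"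
    using mgf_le_envelope[OF Y tail mono rv \<eta>] by metis
  obtain c H where H: "c > 0" "H > 0"
    "\<forall>\<^sub>F t in at_top. c * t powr (\<alpha> - \<eta>) \<le> h t \<and> h t \<le> H * t powr (\<alpha> + \<eta>)"
    using regularly_varying_power_bounds[of 0 h \<alpha> \<eta>] monoD[OF mono] h0 rv \<eta>
    by (smt (verit))
  \<comment> \<open>For \<open>l \<ge> s0\<close> the additive terms \<open>C0 + l L\<close> are at most \<open>C2 l\<close>.\<close>
  define C2 where "C2 = C0 / s0 + L"
  have C2: "C2 \<ge> 0" using CL s0 by (simp add: C2_def)
  define K where "K = (s0 / H) powr (q - 1)"
  have K: "K > 0" using s0 H by (simp add: K_def)
  show ?thesis
  proof (rule that[of "C2 / K + C1"])
    show "C2 / K + C1 \<ge> 0" using C2 K C1 by simp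
    show "\<forall>\<^sub>F t in at_top. \<forall>u. 0 \<le> u \<and> u \<le> U \<longrightarrow>
       mgf M Y (u * h t / t) \<le> exp (h t * ((C2 / K + C1) * u powr ((\<alpha> + \<eta>) / (\<alpha> + \<eta> - 1))))"
      using H(3) eventually_ge_at_top[of T]
    proof eventually_elim
      case (elim t)
      have t: "t \<ge> T" "t > 0" using elim CL(3) by auto
      show ?case unfolding q_def[symmetric]
      proof (intro allI impI)
        fix u assume u: "0 \<le> u \<and> u \<le> U"
        define l where "l = u * h t / t"
        have l0: "l \<ge> 0" using u h0 t by (simp add: l_def)
        show "mgf M Y (u * h t / t) \<le> exp (h t * ((C2 / K + C1) * u powr q))"
        proof (cases "l \<le> s0")
          case True
          have "0 \<le> h t * ((C2 / K + C1) * u powr q)" using h0[of t] C2 K C1(1) by simp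
          then have "1 \<le> exp (h t * ((C2 / K + C1) * u powr q))" by simp
          then show ?thesis using small[OF l0 True] unfolding l_def by linarith
        next
          case False
          then have u0: "u > 0" "h t > 0" using u s0 h0[of t] by (auto simp: l_def less_le)
          have hb: "h t / t \<le> H * t powr (\<alpha> + \<eta> - 1)"
            using elim(1) t by (simp add: powr_diff divide_right_mono)
          have "s0 \<le> u * (h t / t)" using False by (simp add: l_def)
          also have "\<dots> \<le> u * (H * t powr (\<alpha> + \<eta> - 1))" using u hb by (intro mult_left_mono) auto
          finally have "s0 / H \<le> u * t powr (\<alpha> + \<eta> - 1)" using H by (simp add: field_simps)
          then have "K \<le> (u * t powr (\<alpha> + \<eta> - 1)) powr (q - 1)"
            unfolding K_def using s0 H q(2) by (intro powr_mono2) auto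
          also have "\<dots> = u powr (q - 1) * t"
            using u q t \<eta> by (simp add: powr_mult powr_powr)
          finally have "1 / t \<le> u powr (q - 1) / K" using K t by (simp add: field_simps)
          then have "u * (1 / t) \<le> u * (u powr (q - 1) / K)" using u by (intro mult_left_mono) auto
          also have "\<dots> = u powr q / K" using u0 by (simp add: powr_diff)
          finally have ut: "u / t \<le> u powr q / K" by simp
          have "C0 \<le> C0 / s0 * l" using False s0 CL(1) by (simp add: field_simps mult_left_mono)
          then have "C0 + l * L \<le> C2 * l" by (simp add: C2_def algebra_simps)
          also have "\<dots> = C2 * h t * (u / t)" by (simp add: l_def)
          also have "\<dots> \<le> C2 * h t * (u powr q / K)" using C2 u0 ut by (intro mult_left_mono) auto
          finally have "C0 + l * L \<le> C2 * h t * (u powr q / K)" .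
          moreover have "h t * legendre_envelope \<alpha> \<eta> u \<le> h t * (C1 * u powr q)"
            using C1(2)[of u] u u0 by (intro mult_left_mono) auto
          ultimately have "C0 + l * L + h t * legendre_envelope \<alpha> \<eta> u \<le> h t * ((C2 / K + C1) * u powr q)"
            by (simp add: algebra_simps)
          then show ?thesis using CL(4)[OF t(1), of u] u unfolding l_def by (meson exp_le_cancel_iff order_trans)
        qed
      qed
    qed
  qed
qed

section \<open>Tail bounds for the process and its maximum\<close>

text \<open>
The probabilistic data without reference to the generating function: \<open>h\<close> is minus the logarithm of the
tail of the innovations.
\<close>

locale moving_average = prob_space M for M :: "'a measure" +
  fixes g :: "nat \<Rightarrow> real" and X :: "nat \<Rightarrow> 'a \<Rightarrow> real" and h :: "real \<Rightarrow> real" and \<alpha> :: real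
  assumes indep: "indep_vars (\<lambda>_. borel) X {1..}"
    and ident: "\<And>i. i \<ge> 1 \<Longrightarrow> distr M borel (X i) = distr M borel (X 1)"
    and g_nonneg: "\<And>i. g i \<ge> 0"
    and tail: "\<And>x. prob {\<omega> \<in> space M. x < X 1 \<omega>} = exp (- h x)"
    and mono_h: "mono h" and rv_h: "regularly_varying_at_infinity h \<alpha>"
    and h_top: "filterlim h at_top at_top"
    and \<alpha>: "1 < \<alpha>"
    and mgf_finite: "\<And>s. s \<ge> 0 \<Longrightarrow> integrable M (\<lambda>\<omega>. exp (s * X 1 \<omega>))"

context moving_average
begin

lemma X_measurable: "i \<ge> 1 \<Longrightarrow> X i \<in> borel_measurable M"
  using indep unfolding indep_vars_def by auto

lemma process_measurable [measurable]: "gF_process g X n \<in> borel_measurable M"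
  unfolding gF_process_def by (intro borel_measurable_sum borel_measurable_times X_measurable) auto

lemma max_event: "{\<omega> \<in> space M. ereal t < gF_max g X \<omega>} = (\<Union>n. {\<omega> \<in> space M. t < gF_process g X n \<omega>})"
  by (auto simp: gF_max_def less_SUP_iff)

lemma h_nonneg: "h x \<ge> 0"
  using tail[of x] prob_le_1[of "{\<omega> \<in> space M. x < X 1 \<omega>}"] by simp

lemma tail_ident:
  assumes "i \<ge> 1" shows "prob (X i -` {x<..} \<inter> space M) = exp (- h x)"
proof -
  have "prob (X i -` {x<..} \<inter> space M) = measure (distr M borel (X i)) {x<..}"
    using X_measurable[OF assms] by (simp add: measure_distr)
  also have "\<dots> = measure (distr M borel (X 1)) {x<..}" by (simp only: ident[OF assms])
  also have "\<dots> = prob (X 1 -` {x<..} \<inter> space M)"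
    using X_measurable[of 1] by (simp add: measure_distr)
  also have "X 1 -` {x<..} \<inter> space M = {\<omega> \<in> space M. x < X 1 \<omega>}" by auto
  finally show ?thesis using tail by simp
qed

lemma mgf_ident:
  assumes "i \<ge> 1" "s \<ge> 0"
  shows "integrable M (\<lambda>\<omega>. exp (s * X i \<omega>))" "(\<integral>\<omega>. exp (s * X i \<omega>) \<partial>M) = mgf M (X 1) s"
proof -
  have "integrable (distr M borel (X 1)) (\<lambda>x. exp (s * x))"
    using mgf_finite[OF assms(2)] X_measurable[of 1] by (subst integrable_distr_eq) auto
  then have "integrable (distr M borel (X i)) (\<lambda>x. exp (s * x))" by (simp only: ident[OF assms(1)])
  then show "integrable M (\<lambda>\<omega>. exp (s * X i \<omega>))"
    using X_measurable[OF assms(1)] by (subst (asm) integrable_distr_eq) auto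
  have "(\<integral>\<omega>. exp (s * X i \<omega>) \<partial>M) = (\<integral>x. exp (s * x) \<partial>distr M borel (X i))"
    using X_measurable[OF assms(1)] by (subst integral_distr) auto
  also have "\<dots> = (\<integral>x. exp (s * x) \<partial>distr M borel (X 1))" by (simp only: ident[OF assms(1)])
  also have "\<dots> = mgf M (X 1) s"
    unfolding mgf_def using X_measurable[of 1] by (subst integral_distr) auto
  finally show "(\<integral>\<omega>. exp (s * X i \<omega>) \<partial>M) = mgf M (X 1) s" .
qed

lemma process_eq: "gF_process g X n \<omega> = (\<Sum>j\<in>{1..n}. g (n - j) * X j \<omega>)"
  unfolding gF_process_def by (rule sum.reindex_bij_witness[of _ "\<lambda>j. n - j" "\<lambda>i. n - i"]) auto

lemma process_chernoff:
  assumes l: "l \<ge> 0"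
  shows "prob {\<omega> \<in> space M. t < gF_process g X n \<omega>} \<le> exp (- l * t) * (\<Prod>i<n. mgf M (X 1) (l * g i))"
proof -
  have e: "exp (l * (gF_process g X n \<omega> - t)) = exp (- l * t) * (\<Prod>j\<in>{1..n}. exp (l * g (n - j) * X j \<omega>))" for \<omega>
    unfolding process_eq
    by (simp add: exp_sum[symmetric] exp_add[symmetric] sum_distrib_left algebra_simps)
  have ind: "indep_vars (\<lambda>_. borel) (\<lambda>j \<omega>. exp (l * g (n - j) * X j \<omega>)) {1..n}"
    using indep_vars_compose2[OF indep_vars_subset[OF indep, of "{1..n}"], of "\<lambda>j x. exp (l * g (n - j) * x)" "\<lambda>_. borel"]
    by auto
  have int: "integrable M (\<lambda>\<omega>. exp (l * g (n - j) * X j \<omega>))" if "j \<in> {1..n}" for j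
    using that l g_nonneg by (intro mgf_ident) auto
  have "prob {\<omega> \<in> space M. t < gF_process g X n \<omega>}
      = (\<integral>\<omega>. indicator {\<omega> \<in> space M. t < gF_process g X n \<omega>} \<omega> \<partial>M)"
    by simp
  also have "\<dots> \<le> (\<integral>\<omega>. exp (l * (gF_process g X n \<omega> - t)) \<partial>M)"
  proof (intro integral_mono)
    show "integrable M (\<lambda>\<omega>. exp (l * (gF_process g X n \<omega> - t)))"
      unfolding e by (intro integrable_mult_right indep_vars_integrable ind int) auto
    show "integrable M (\<lambda>\<omega>. indicator {\<omega> \<in> space M. t < gF_process g X n \<omega>} \<omega> :: real)"
      by (intro integrable_real_indicator) (auto simp: emeasure_eq_measure)
  qed (use l in \<open>auto simp: indicator_def\<close>)
  also have "\<dots> = exp (- l * t) * (\<integral>\<omega>. (\<Prod>j\<in>{1..n}. exp (l * g (n - j) * X j \<omega>)) \<partial>M)"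
    unfolding e by simp
  also have "(\<integral>\<omega>. (\<Prod>j\<in>{1..n}. exp (l * g (n - j) * X j \<omega>)) \<partial>M)
     = (\<Prod>j\<in>{1..n}. \<integral>\<omega>. exp (l * g (n - j) * X j \<omega>) \<partial>M)"
    by (intro indep_vars_lebesgue_integral ind int) auto
  also have "\<dots> = (\<Prod>j\<in>{1..n}. mgf M (X 1) (l * g (n - j)))"
    using l g_nonneg by (intro prod.cong mgf_ident) auto
  also have "\<dots> = (\<Prod>i<n. mgf M (X 1) (l * g i))"
    by (rule prod.reindex_bij_witness[of _ "\<lambda>i. n - i" "\<lambda>j. n - j"]) auto
  finally show ?thesis .
qed

lemma mgf_nonneg: "mgf M Y s \<ge> 0"
  unfolding mgf_def by (intro Bochner_Integration.integral_nonneg) auto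

text \<open>
Chernoff's inequality with \<open>\<lambda> = \<theta> h(t) / t\<close>. The sum of \<open>log \<phi>(\<lambda> g\<^sub>i)\<close> is split at a fixed index \<open>N\<close>: the
terms below \<open>N\<close> are governed by \<open>log_mgf_limsup\<close>, and the rest is small by \<open>log_mgf_dominated\<close> and the
summability of \<open>g\<^sub>i\<^sup>q\<close>. All these bounds are nonnegative, so the result does not depend on \<open>n\<close>.
\<close>

lemma process_uniform_bound:
  fixes B \<delta> :: real
  assumes bd: "\<And>i. g i \<le> K" and s0: "s0 > 0" and small: "\<And>s. 0 \<le> s \<Longrightarrow> s \<le> s0 \<Longrightarrow> mgf M (X 1) s \<le> 1"
    and \<eta>: "0 < \<eta>" "\<eta> < 1" "\<eta> < \<alpha> - 1" and sq: "summable (\<lambda>i. g i powr ((\<alpha> + \<eta>) / (\<alpha> + \<eta> - 1)))"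
    and sB: "(\<lambda>i. g i powr (\<alpha> / (\<alpha> - 1))) sums B" and B: "B > 0" and \<delta>: "\<delta> > 0"
  shows "\<forall>\<^sub>F t in at_top. \<forall>n. prob {\<omega> \<in> space M. t < gF_process g X n \<omega>}
      \<le> exp (- (B powr (1 - \<alpha>) - \<delta>) * h t)"
proof -
  define \<kappa> where "\<kappa> = B powr (1 - \<alpha>)"
  \<comment> \<open>The maximiser of \<open>\<theta> - B \<psi>(\<theta>)\<close>, whose maximum is \<open>\<kappa>\<close>.\<close>
  define \<theta> where "\<theta> = \<alpha> * \<kappa>"
  define \<beta> where "\<beta> = \<alpha> / (\<alpha> - 1)"
  define q where "q = (\<alpha> + \<eta>) / (\<alpha> + \<eta> - 1)"
  define \<psi> where "\<psi> i = legendre_power \<alpha> 1 (\<theta> * g i)" for i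
  have \<theta>: "\<theta> > 0" using B \<alpha> by (simp add: \<theta>_def \<kappa>_def)
  have \<beta>: "\<beta> > 1" "\<beta> = 1 + 1 / (\<alpha> - 1)" using \<alpha> by (auto simp: \<beta>_def field_simps)
  have X1: "random_variable borel (X 1)" using X_measurable by simp
  obtain C where C: "C \<ge> 0"
    "\<forall>\<^sub>F t in at_top. \<forall>u. 0 \<le> u \<and> u \<le> \<theta> * K \<longrightarrow>
       mgf M (X 1) (u * h t / t) \<le> exp (h t * (C * u powr q))"
    unfolding q_def by (rule log_mgf_dominated[OF X1 tail mono_h rv_h \<eta> s0 small, of "\<theta> * K"]) blast+
  have "summable (\<lambda>i. C * \<theta> powr q * g i powr q)" using sq unfolding q_def by (intro summable_mult)
  then obtain N where N: "\<And>m n. m \<ge> N \<Longrightarrow> norm (\<Sum>i=m..n. C * \<theta> powr q * g i powr q) < \<delta> / 2"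
    using summable_partial_sum_bound[of "\<lambda>i. C * \<theta> powr q * g i powr q" "\<delta> / 2"] \<delta> by (metis half_gt_zero)
  have tailsum: "(\<Sum>i\<in>{N..<n}. C * (\<theta> * g i) powr q) \<le> \<delta> / 2" for n
  proof (cases n)
    case (Suc m)
    have "(\<Sum>i\<in>{N..<n}. C * (\<theta> * g i) powr q) = (\<Sum>i=N..m. C * \<theta> powr q * g i powr q)"
      using \<theta> g_nonneg by (intro sum.cong) (auto simp: Suc powr_mult)
    then show ?thesis using N[of N m] by simp
  qed (use \<delta> in auto)
  \<comment> \<open>An error of \<open>d\<close> in each of \<open>N\<close> terms adds up to at most \<open>\<delta> / 2\<close>.\<close>
  define d where "d = \<delta> / (2 * (real N + 1))"
  have d: "d > 0" "real N * d \<le> \<delta> / 2" using \<delta> by (auto simp: d_def field_simps)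
  have "\<forall>\<^sub>F t in at_top. \<forall>i\<in>{..<N}. mgf M (X 1) (\<theta> * g i * h t / t) \<le> exp (h t * (\<psi> i + d))"
    unfolding \<psi>_def using \<theta> g_nonneg d
    by (intro eventually_ball_finite ballI log_mgf_limsup[OF X1 tail mono_h rv_h \<alpha> h_top]) auto
  moreover note C(2)
  moreover have "\<forall>\<^sub>F t in at_top. t > (0::real)" by (rule eventually_gt_at_top)
  ultimately show ?thesis
  proof eventually_elim
    case (elim t)
    show ?case
    proof
      fix n
      define e where "e i = (if i < N then \<psi> i + d else C * (\<theta> * g i) powr q)" for i
      define l where "l = \<theta> * h t / t"
      have l0: "l \<ge> 0" using \<theta> elim h_nonneg[of t] by (simp add: l_def)
      have "mgf M (X 1) (l * g i) \<le> exp (h t * e i)" for i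
      proof (cases "i < N")
        case True then show ?thesis using elim(1) by (auto simp: l_def e_def mult_ac)
      next
        case False then show ?thesis
          using elim(2)[rule_format, of "\<theta> * g i"] bd[of i] g_nonneg[of i] \<theta>
          by (simp add: l_def e_def mult_ac)
      qed
      then have "(\<Prod>i<n. mgf M (X 1) (l * g i)) \<le> (\<Prod>i<n. exp (h t * e i))"
        by (intro prod_mono) (auto simp: mgf_nonneg)
      also have "\<dots> = exp (h t * (\<Sum>i<n. e i))" by (simp add: exp_sum sum_distrib_left)
      finally have P: "(\<Prod>i<n. mgf M (X 1) (l * g i)) \<le> exp (h t * (\<Sum>i<n. e i))" .
      have \<psi>e: "\<psi> i = (\<theta> powr \<beta> / (\<beta> * \<alpha> powr (1 / (\<alpha> - 1)))) * g i powr \<beta>" for i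
        using \<theta> g_nonneg by (simp add: \<psi>_def legendre_power_def \<beta>_def powr_mult)
      have \<psi>0: "\<psi> i \<ge> 0" for i unfolding \<psi>e using \<beta> \<alpha> by simp
      have "(\<Sum>i<n. e i) \<le> (\<Sum>i<n. \<psi> i + ((if i < N then d else 0) + (if i \<in> {N..<n} then C * (\<theta> * g i) powr q else 0)))"
        using \<psi>0 by (intro sum_mono) (auto simp: e_def)
      also have "\<dots> = (\<Sum>i<n. \<psi> i) + ((\<Sum>i<n. if i < N then d else 0) + (\<Sum>i<n. if i \<in> {N..<n} then C * (\<theta> * g i) powr q else 0))"
        by (simp add: sum.distrib)
      also have "(\<Sum>i<n. if i < N then d else 0) \<le> \<delta> / 2"
      proof -
        have "(\<Sum>i<n. if i < N then d else 0) = (\<Sum>i\<in>{..<n} \<inter> {i. i < N}. d)"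
          by (subst sum.inter_restrict) auto
        also have "\<dots> \<le> (\<Sum>i\<in>{..<N}. d)" using d by (intro sum_mono2) auto
        finally show ?thesis using d by simp
      qed
      also have "(\<Sum>i<n. if i \<in> {N..<n} then C * (\<theta> * g i) powr q else 0) \<le> \<delta> / 2"
      proof -
        have "(\<Sum>i<n. if i \<in> {N..<n} then C * (\<theta> * g i) powr q else 0) = (\<Sum>i\<in>{..<n} \<inter> {N..<n}. C * (\<theta> * g i) powr q)"
          by (rule sum.inter_restrict[symmetric]) simp
        also have "{..<n} \<inter> {N..<n} = {N..<n}" by auto
        finally show ?thesis using tailsum[of n] by simp
      qed
      also have "(\<Sum>i<n. \<psi> i) \<le> \<kappa> * (\<alpha> - 1)"
      proof -
        have "(\<Sum>i<n. \<psi> i) = (\<theta> powr \<beta> / (\<beta> * \<alpha> powr (1 / (\<alpha> - 1)))) * (\<Sum>i<n. g i powr \<beta>)"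
          unfolding \<psi>e by (simp add: sum_distrib_left)
        also have "\<dots> \<le> (\<theta> powr \<beta> / (\<beta> * \<alpha> powr (1 / (\<alpha> - 1)))) * B"
          using sum_le_suminf[OF sums_summable[OF sB], of "{..<n}"] sums_unique[OF sB] \<beta> \<alpha> unfolding \<beta>_def[symmetric]
          by (intro mult_left_mono) auto
        also have "\<theta> powr \<beta> = \<alpha> powr \<beta> * \<kappa> powr \<beta>" using \<alpha> by (simp add: \<theta>_def \<kappa>_def powr_mult)
        also have "\<alpha> powr \<beta> = \<alpha> * \<alpha> powr (1 / (\<alpha> - 1))" unfolding \<beta>(2) using \<alpha> by (simp add: powr_add)
        also have "\<kappa> powr \<beta> = \<kappa> * \<kappa> powr (1 / (\<alpha> - 1))" unfolding \<beta>(2) using B by (simp add: powr_add \<kappa>_def)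
        also have "\<kappa> powr (1 / (\<alpha> - 1)) = B powr (- 1)"
        proof -
          have "(1 - \<alpha>) * (1 / (\<alpha> - 1)) = - 1" using \<alpha> by (simp add: field_simps)
          then show ?thesis unfolding \<kappa>_def powr_powr by simp
        qed
        also have "B powr (- 1) = 1 / B" using B by (simp add: powr_minus_divide)
        also have "\<alpha> * \<alpha> powr (1 / (\<alpha> - 1)) * (\<kappa> * (1 / B)) / (\<beta> * \<alpha> powr (1 / (\<alpha> - 1))) * B = \<alpha> / \<beta> * \<kappa>"
          using B \<alpha> by simp
        also have "\<alpha> / \<beta> = \<alpha> - 1" using \<alpha> by (simp add: \<beta>_def)
        finally show ?thesis by (simp add: mult.commute)
      qed
      finally have E: "(\<Sum>i<n. e i) \<le> \<kappa> * (\<alpha> - 1) + (\<delta> / 2 + \<delta> / 2)" by simp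
      have "prob {\<omega> \<in> space M. t < gF_process g X n \<omega>} \<le> exp (- l * t) * (\<Prod>i<n. mgf M (X 1) (l * g i))"
        by (rule process_chernoff[OF l0])
      also have "\<dots> \<le> exp (- l * t) * exp (h t * (\<Sum>i<n. e i))" using P by (intro mult_left_mono) auto
      also have "\<dots> = exp (h t * ((\<Sum>i<n. e i) - \<theta>))"
        using elim(3) by (simp add: exp_add[symmetric] l_def algebra_simps)
      also have "\<dots> \<le> exp (h t * (- (\<kappa> - \<delta>)))"
        using E h_nonneg[of t] by (intro exp_le_cancel_iff[THEN iffD2] mult_left_mono) (auto simp: \<theta>_def algebra_simps)
      finally show "prob {\<omega> \<in> space M. t < gF_process g X n \<omega>} \<le> exp (- (B powr (1 - \<alpha>) - \<delta>) * h t)"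
        by (simp add: \<kappa>_def mult.commute)
    qed
  qed
qed

text \<open>
Chernoff's inequality with \<open>\<lambda> = s\<^sub>0 / K\<close>, chosen so that every \<open>\<lambda> g\<^sub>i\<close> lies in the interval where the
negative mean makes \<open>log \<phi>\<close> at most linear and negative.
\<close>

lemma process_drift_bound:
  assumes bd: "\<And>i. g i \<le> K" and K: "K > 0" and s0: "s0 > 0"
    and small: "\<And>s. 0 \<le> s \<Longrightarrow> s \<le> s0 \<Longrightarrow> mgf M (X 1) s \<le> exp (- c * s)" and t: "t \<ge> 0"
  shows "prob {\<omega> \<in> space M. t < gF_process g X n \<omega>} \<le> exp (- (c * (s0 / K)) * (\<Sum>i<n. g i))"
proof -
  define l where "l = s0 / K"
  have l: "l \<ge> 0" using s0 K by (simp add: l_def)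
  have "mgf M (X 1) (l * g i) \<le> exp (- c * (l * g i))" for i
  proof (rule small)
    show "0 \<le> l * g i" using l g_nonneg by simp
    show "l * g i \<le> s0" using bd[of i] s0 K by (simp add: l_def field_simps)
  qed
  then have "(\<Prod>i<n. mgf M (X 1) (l * g i)) \<le> (\<Prod>i<n. exp (- c * (l * g i)))"
    by (intro prod_mono) (auto simp: mgf_nonneg)
  also have "\<dots> = exp (- (c * l) * (\<Sum>i<n. g i))"
    by (subst exp_sum[symmetric]) (auto simp: sum_distrib_left mult_ac sum_negf)
  finally have "exp (- l * t) * (\<Prod>i<n. mgf M (X 1) (l * g i)) \<le> 1 * exp (- (c * l) * (\<Sum>i<n. g i))"
    using l t by (intro mult_mono) (auto intro: prod_nonneg mgf_nonneg)
  then show ?thesis using process_chernoff[OF l, of t n] unfolding l_def by linarith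
qed

text \<open>
The uniform bound has the right exponent but cannot be summed over \<open>n\<close>, while the drift bound is
summable but does not see \<open>t\<close>. Both properties survive in the product of their powers \<open>1 - \<epsilon>\<close> and \<open>\<epsilon>\<close>.
\<close>

lemma max_upper_bound:
  fixes \<kappa> :: real
  assumes unif: "\<forall>\<^sub>F t in at_top. \<forall>n. prob {\<omega> \<in> space M. t < gF_process g X n \<omega>} \<le> exp (- \<kappa> * h t)"
    and drift: "\<And>t n. t \<ge> 0 \<Longrightarrow> prob {\<omega> \<in> space M. t < gF_process g X n \<omega>} \<le> exp (- a * (\<Sum>i<n. g i))"
    and summ: "\<And>b. b > 0 \<Longrightarrow> summable (\<lambda>n. exp (- b * (\<Sum>i<n. g i)))"
    and a: "a > 0" and \<epsilon>: "0 < \<epsilon>" "\<epsilon> < 1"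
  obtains A where "A > 0"
    "\<forall>\<^sub>F t in at_top. prob {\<omega> \<in> space M. ereal t < gF_max g X \<omega>} \<le> A * exp (- ((1 - \<epsilon>) * \<kappa>) * h t)"
proof -
  define b where "b n = exp (- (\<epsilon> * a) * (\<Sum>i<n. g i))" for n
  have sb: "summable b" unfolding b_def using summ[of "\<epsilon> * a"] a \<epsilon> by simp
  have "\<forall>\<^sub>F t in at_top. prob {\<omega> \<in> space M. ereal t < gF_max g X \<omega>} \<le> suminf b * exp (- ((1 - \<epsilon>) * \<kappa>) * h t)"
    using unif eventually_ge_at_top[of 0]
  proof eventually_elim
    case (elim t)
    define p where "p n = prob {\<omega> \<in> space M. t < gF_process g X n \<omega>}" for n
    define E where "E = exp (- ((1 - \<epsilon>) * \<kappa>) * h t)"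
    have pb: "p n \<le> b n * E" for n
    proof -
      have "p n = p n powr \<epsilon> * p n powr (1 - \<epsilon>)"
        by (simp add: powr_add[symmetric] p_def)
      also have "\<dots> \<le> exp (- a * (\<Sum>i<n. g i)) powr \<epsilon> * exp (- \<kappa> * h t) powr (1 - \<epsilon>)"
        using elim(1) drift[OF elim(2), of n] \<epsilon> unfolding p_def by (intro mult_mono powr_mono2) auto
      also have "\<dots> = b n * E"
        by (simp add: b_def E_def powr_def mult_ac)
      finally show ?thesis .
    qed
    have sE: "summable (\<lambda>n. b n * E)" using sb by (rule summable_mult2)
    have sp: "summable p"
      by (rule summable_comparison_test[OF _ sE]) (use pb in \<open>auto simp: p_def\<close>)
    have "prob {\<omega> \<in> space M. ereal t < gF_max g X \<omega>} \<le> suminf p"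
      unfolding max_event p_def
      by (rule finite_measure_subadditive_countably) (use sp in \<open>auto simp: p_def[abs_def]\<close>)
    also have "\<dots> \<le> (\<Sum>n. b n * E)" using sp sE pb by (intro suminf_le) auto
    also have "\<dots> = suminf b * E" using sb by (rule suminf_mult2[symmetric])
    finally show ?case unfolding E_def .
  qed
  moreover have "suminf b > 0" using sb by (intro suminf_pos) (auto simp: b_def)
  ultimately show ?thesis using that by blast
qed

lemma h_scaled_limit:
  assumes "c \<ge> 0" shows "((\<lambda>t. h (c * t) / h t) \<longlongrightarrow> c powr \<alpha>) at_top"
proof (cases "c = 0")
  case True
  \<comment> \<open>The value \<open>c = 0\<close> occurs for vanishing coefficients; \<open>0 powr \<alpha> = 0\<close> is then the correct limit.\<close>
  have "((\<lambda>t. h 0 / h t) \<longlongrightarrow> 0) at_top"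
    using h_top by (intro real_tendsto_divide_at_top[OF tendsto_const]) auto
  then show ?thesis using True by simp
qed (use rv_h assms in \<open>auto simp: regularly_varying_at_infinity_def\<close>)

text \<open>
The joint exceedance of the levels \<open>c\<^sub>i t\<close> by the independent variables \<open>X\<^bsub>N-i\<^esub>\<close> forces \<open>S\<^sub>N > t\<close>.
\<close>

lemma max_lower_bound:
  fixes c :: "nat \<Rightarrow> real"
  assumes c: "\<And>i. i < N \<Longrightarrow> c i \<ge> 0" "(\<Sum>i<N. g i * c i) = 1" and g0: "g 0 > 0" and k: "k > (\<Sum>i<N. c i powr \<alpha>)"
  shows "\<forall>\<^sub>F t in at_top. prob {\<omega> \<in> space M. ereal t < gF_max g X \<omega>} > 0 \<and>
     - ln (prob {\<omega> \<in> space M. ereal t < gF_max g X \<omega>}) / h t \<le> k"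
proof -
  have N: "N > 0" using c(2) by (cases N) auto
  have "((\<lambda>t. \<Sum>i<N. h (c i * t) / h t) \<longlongrightarrow> (\<Sum>i<N. c i powr \<alpha>)) at_top"
    using c by (intro tendsto_sum h_scaled_limit) auto
  then have "\<forall>\<^sub>F t in at_top. (\<Sum>i<N. h (c i * t) / h t) < k"
    using k by (rule order_tendstoD(2))
  moreover have "\<forall>\<^sub>F t in at_top. h t > 0" using h_top by (simp add: filterlim_at_top_dense)
  ultimately show ?thesis
  proof eventually_elim
    case (elim t)
    define A where "A = (\<Inter>j\<in>{1..N}. X j -` {c (N - j) * t<..} \<inter> space M)"
    have "prob A = (\<Prod>j\<in>{1..N}. prob (X j -` {c (N - j) * t<..} \<inter> space M))"
      unfolding A_def by (rule indep_varsD[OF indep]) (use N in auto)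
    also have "\<dots> = (\<Prod>j\<in>{1..N}. exp (- h (c (N - j) * t)))"
      by (intro prod.cong refl tail_ident) auto
    also have "\<dots> = (\<Prod>i<N. exp (- h (c i * t)))"
      by (rule prod.reindex_bij_witness[of _ "\<lambda>i. N - i" "\<lambda>j. N - j"]) auto
    also have "\<dots> = exp (- (\<Sum>i<N. h (c i * t)))" by (simp add: exp_sum[symmetric] sum_negf)
    finally have PA: "prob A = exp (- (\<Sum>i<N. h (c i * t)))" .
    have "A \<subseteq> {\<omega> \<in> space M. t < gF_process g X N \<omega>}"
    proof
      fix \<omega> assume "\<omega> \<in> A"
      then have w: "\<omega> \<in> space M" "\<And>j. j \<in> {1..N} \<Longrightarrow> c (N - j) * t < X j \<omega>"
        using N by (auto simp: A_def Suc_le_eq)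
      have i: "c i * t < X (N - i) \<omega>" if "i < N" for i using w(2)[of "N - i"] that by simp
      have "t = (\<Sum>i<N. g i * c i) * t" using c by simp
      also have "\<dots> = (\<Sum>i<N. g i * (c i * t))" by (simp only: sum_distrib_right mult.assoc)
      also have "\<dots> < (\<Sum>i<N. g i * X (N - i) \<omega>)"
      proof (rule sum_strict_mono_ex1)
        show "\<forall>j\<in>{..<N}. g j * (c j * t) \<le> g j * X (N - j) \<omega>"
          using i g_nonneg by (simp add: mult_left_mono less_imp_le)
        show "\<exists>j\<in>{..<N}. g j * (c j * t) < g j * X (N - j) \<omega>"
          using i[OF N] g0 N by (intro bexI[of _ 0] mult_strict_left_mono) auto
      qed simp
      finally show "\<omega> \<in> {\<omega> \<in> space M. t < gF_process g X N \<omega>}" using w by (simp add: gF_process_def)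
    qed
    also have "\<dots> \<subseteq> {\<omega> \<in> space M. ereal t < gF_max g X \<omega>}" unfolding max_event by blast
    finally have "prob A \<le> prob {\<omega> \<in> space M. ereal t < gF_max g X \<omega>}"
      by (intro finite_measure_mono) (auto simp: max_event)
    then have le: "exp (- (\<Sum>i<N. h (c i * t))) \<le> prob {\<omega> \<in> space M. ereal t < gF_max g X \<omega>}" by (simp add: PA)
    then have pos: "prob {\<omega> \<in> space M. ereal t < gF_max g X \<omega>} > 0" by (meson exp_gt_zero less_le_trans)
    then have "- (\<Sum>i<N. h (c i * t)) \<le> ln (prob {\<omega> \<in> space M. ereal t < gF_max g X \<omega>})"
      using le by (simp add: ln_ge_iff)
    then have "- ln (prob {\<omega> \<in> space M. ereal t < gF_max g X \<omega>}) / h t \<le> (\<Sum>i<N. h (c i * t)) / h t"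
      using elim by (intro divide_right_mono) auto
    also have "\<dots> = (\<Sum>i<N. h (c i * t) / h t)" by (rule sum_divide_distrib)
    finally show ?case using pos elim by simp
  qed
qed

text \<open>
The minimiser of \<open>\<Sum> c\<^sub>i\<^sup>\<alpha>\<close> under \<open>\<Sum> g\<^sub>i c\<^sub>i = 1\<close>, the equality case of Hoelder's inequality, is
\<open>c\<^sub>i = g\<^sub>i\<^bsup>\<beta>-1\<^esup> / B\<close>.
\<close>

lemma max_lower_bound_norm:
  assumes g0: "g 0 > 0" and N: "N > 0" and k: "k > (\<Sum>i<N. g i powr (\<alpha> / (\<alpha> - 1))) powr (1 - \<alpha>)"
  shows "\<forall>\<^sub>F t in at_top. prob {\<omega> \<in> space M. ereal t < gF_max g X \<omega>} > 0 \<and>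
     - ln (prob {\<omega> \<in> space M. ereal t < gF_max g X \<omega>}) / h t \<le> k"
proof -
  define \<beta> where "\<beta> = \<alpha> / (\<alpha> - 1)"
  have \<beta>: "\<beta> - 1 = 1 / (\<alpha> - 1)" "(\<beta> - 1) * \<alpha> = \<beta>" using \<alpha> by (auto simp: \<beta>_def field_simps)
  define B where "B = (\<Sum>i<N. g i powr \<beta>)"
  have "g 0 powr \<beta> \<le> B" unfolding B_def using N by (intro member_le_sum) auto
  moreover have "g 0 powr \<beta> > 0" using g0 by simp
  ultimately have B: "B > 0" by linarith
  have gg: "g i * g i powr (\<beta> - 1) = g i powr \<beta>" for i
    using g_nonneg[of i] by (cases "g i = 0") (auto simp: powr_diff)
  show ?thesis
  proof (rule max_lower_bound[where c = "\<lambda>i. g i powr (\<beta> - 1) / B", OF _ _ g0])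
    show "(\<Sum>i<N. g i * (g i powr (\<beta> - 1) / B)) = 1"
      using B gg by (simp add: sum_divide_distrib[symmetric] B_def[symmetric])
    have "(\<Sum>i<N. (g i powr (\<beta> - 1) / B) powr \<alpha>) = (\<Sum>i<N. g i powr \<beta> / B powr \<alpha>)"
      using B by (intro sum.cong) (auto simp: powr_divide powr_powr \<beta>(2))
    also have "\<dots> = B powr (1 - \<alpha>)" using B by (simp add: sum_divide_distrib[symmetric] B_def[symmetric] powr_diff)
    finally show "(\<Sum>i<N. (g i powr (\<beta> - 1) / B) powr \<alpha>) < k" using k by (simp add: B_def \<beta>_def)
  qed (use B in auto)
qed

lemma max_log_less:
  assumes g0: "g 0 > 0"
    and lim: "(\<lambda>N. (\<Sum>i<N. g i powr (\<alpha> / (\<alpha> - 1))) powr (1 - \<alpha>)) \<longlonglongrightarrow> \<kappa>" and k: "\<kappa> < k"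
  shows "\<forall>\<^sub>F t in at_top. prob {\<omega> \<in> space M. ereal t < gF_max g X \<omega>} > 0 \<and>
     - ln (prob {\<omega> \<in> space M. ereal t < gF_max g X \<omega>}) / h t < k"
proof -
  obtain k' where k': "\<kappa> < k'" "k' < k" using k dense by blast
  have "\<forall>\<^sub>F N in sequentially. (\<Sum>i<N. g i powr (\<alpha> / (\<alpha> - 1))) powr (1 - \<alpha>) < k' \<and> N > 0"
    using order_tendstoD(2)[OF lim k'(1)] eventually_gt_at_top[of 0] by eventually_elim auto
  then obtain N where "(\<Sum>i<N. g i powr (\<alpha> / (\<alpha> - 1))) powr (1 - \<alpha>) < k'" "N > 0"
    using eventually_happens'[OF sequentially_bot] by blast
  from max_lower_bound_norm[OF g0 this(2,1)] show ?thesis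
    by eventually_elim (use k' in auto)
qed

lemma max_log_limit_summable:
  assumes neg: "ext_mean M (X 1) < 0" and g0: "g 0 > 0" and bd: "\<And>i. g i \<le> K"
    and \<eta>: "0 < \<eta>" "\<eta> < 1" "\<eta> < \<alpha> - 1" and sq: "summable (\<lambda>i. g i powr ((\<alpha> + \<eta>) / (\<alpha> + \<eta> - 1)))"
    and summ: "\<And>a. a > 0 \<Longrightarrow> summable (\<lambda>n. exp (- a * (\<Sum>i<n. g i)))"
    and sB: "(\<lambda>i. g i powr (\<alpha> / (\<alpha> - 1))) sums B" and B: "B > 0"
  shows "((\<lambda>t. - ln (prob {\<omega> \<in> space M. ereal t < gF_max g X \<omega>}) / h t) \<longlongrightarrow> B powr (1 - \<alpha>)) at_top"
proof (rule order_tendstoI)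
  define \<kappa> where "\<kappa> = B powr (1 - \<alpha>)"
  have "(\<lambda>N. (\<Sum>i<N. g i powr (\<alpha> / (\<alpha> - 1)))) \<longlonglongrightarrow> B" using sB by (simp add: sums_def)
  then have lim: "(\<lambda>N. (\<Sum>i<N. g i powr (\<alpha> / (\<alpha> - 1))) powr (1 - \<alpha>)) \<longlonglongrightarrow> \<kappa>"
    unfolding \<kappa>_def by (rule tendsto_powr[OF _ tendsto_const]) (use B in auto)
  note low = max_log_less[OF g0 lim]
  show "\<forall>\<^sub>F t in at_top. - ln (prob {\<omega> \<in> space M. ereal t < gF_max g X \<omega>}) / h t < k" if "B powr (1 - \<alpha>) < k" for k
    using low[of k] that by (auto simp: \<kappa>_def elim: eventually_mono)
  fix k assume k: "k < B powr (1 - \<alpha>)"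
  have X1: "random_variable borel (X 1)" using X_measurable by simp
  obtain s0 c where s0: "s0 > 0" "c > 0" "\<And>s. 0 \<le> s \<Longrightarrow> s \<le> s0 \<Longrightarrow> mgf M (X 1) s \<le> exp (- c * s)"
    using mgf_linear_bound[OF X1 neg mgf_finite] by blast
  have small: "mgf M (X 1) s \<le> 1" if "0 \<le> s" "s \<le> s0" for s
  proof -
    have "exp (- c * s) \<le> 1" using that s0 by simp
    then show ?thesis using s0(3)[OF that] by linarith
  qed
  have K: "K > 0" using g0 bd[of 0] by linarith
  have \<kappa>: "\<kappa> > 0" using B by (simp add: \<kappa>_def)
  define m where "m = max k 0"
  have m: "k \<le> m" "0 \<le> m" "m < \<kappa>" using k \<kappa> by (auto simp: m_def \<kappa>_def)
  obtain k1 where k1: "m < k1" "k1 < \<kappa>" using dense[OF m(3)] by blast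
  \<comment> \<open>Chosen so that \<open>(1 - \<epsilon>) k1\<close> is the midpoint of \<open>m\<close> and \<open>k1\<close>, hence still larger than \<open>k\<close>.\<close>
  define \<epsilon> where "\<epsilon> = (k1 - m) / (2 * k1)"
  have \<epsilon>: "0 < \<epsilon>" "\<epsilon> < 1" using k1 m by (auto simp: \<epsilon>_def field_simps)
  have "(1 - \<epsilon>) * k1 = (k1 + m) / 2" using k1 m by (simp add: \<epsilon>_def field_simps)
  moreover have "k < (k1 + m) / 2" using k1 m by simp
  ultimately have kk: "k < (1 - \<epsilon>) * k1" by simp
  have unif: "\<forall>\<^sub>F t in at_top. \<forall>n. prob {\<omega> \<in> space M. t < gF_process g X n \<omega>} \<le> exp (- k1 * h t)"
    using process_uniform_bound[OF bd s0(1) small \<eta> sq sB B, of "\<kappa> - k1"] k1 by (simp add: \<kappa>_def)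
  have "c * (s0 / K) > 0" using s0 K by simp
  then obtain A where A: "A > 0"
    "\<forall>\<^sub>F t in at_top. prob {\<omega> \<in> space M. ereal t < gF_max g X \<omega>} \<le> A * exp (- ((1 - \<epsilon>) * k1) * h t)"
    using max_upper_bound[OF unif process_drift_bound[OF bd K s0(1) s0(3)] summ _ \<epsilon>] by blast
  have "\<forall>\<^sub>F t in at_top. h t > max 0 (ln A / ((1 - \<epsilon>) * k1 - k))"
    by (rule h_top[unfolded filterlim_at_top_dense, rule_format])
  then show "\<forall>\<^sub>F t in at_top. k < - ln (prob {\<omega> \<in> space M. ereal t < gF_max g X \<omega>}) / h t"
    using A(2) low[OF less_add_one]
  proof eventually_elim
    case (elim t)
    define P where "P = prob {\<omega> \<in> space M. ereal t < gF_max g X \<omega>}"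
    have "ln P \<le> ln (A * exp (- ((1 - \<epsilon>) * k1) * h t))"
      using elim A(1) unfolding P_def by (intro ln_mono) auto
    also have "\<dots> = ln A - (1 - \<epsilon>) * k1 * h t" using A(1) by (simp add: ln_mult)
    finally have "- ln P \<ge> (1 - \<epsilon>) * k1 * h t - ln A" by simp
    moreover have "ln A < h t * ((1 - \<epsilon>) * k1 - k)" using elim(1) kk by (simp add: field_simps)
    ultimately have "k * h t < - ln P" by (simp add: algebra_simps)
    then show ?case using elim(1) unfolding P_def[symmetric] by (simp add: field_simps)
  qed
qed

lemma max_log_limit_not_summable:
  assumes g0: "g 0 > 0" and ns: "\<not> summable (\<lambda>i. g i powr (\<alpha> / (\<alpha> - 1)))"
  shows "((\<lambda>t. - ln (prob {\<omega> \<in> space M. ereal t < gF_max g X \<omega>}) / h t) \<longlongrightarrow> 0) at_top"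
proof (rule order_tendstoI)
  have "filterlim (\<lambda>N. (\<Sum>i<N. g i powr (\<alpha> / (\<alpha> - 1)))) at_top sequentially"
    unfolding filterlim_at_top eventually_sequentially
  proof
    fix Z :: real
    have "\<exists>n. Z < (\<Sum>i\<le>n. g i powr (\<alpha> / (\<alpha> - 1)))"
      using ns bounded_imp_summable[of "\<lambda>i. g i powr (\<alpha> / (\<alpha> - 1))" Z] by (auto simp: not_le[symmetric])
    then obtain n where n: "Z < (\<Sum>i\<le>n. g i powr (\<alpha> / (\<alpha> - 1)))" by blast
    have "Z \<le> (\<Sum>i<N. g i powr (\<alpha> / (\<alpha> - 1)))" if "N \<ge> Suc n" for N
    proof -
      have "(\<Sum>i\<le>n. g i powr (\<alpha> / (\<alpha> - 1))) \<le> (\<Sum>i<N. g i powr (\<alpha> / (\<alpha> - 1)))"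
        using that by (intro sum_mono2) auto
      then show ?thesis using n by linarith
    qed
    then show "\<exists>N. \<forall>n\<ge>N. Z \<le> (\<Sum>i<n. g i powr (\<alpha> / (\<alpha> - 1)))" by blast
  qed
  then have lim: "(\<lambda>N. (\<Sum>i<N. g i powr (\<alpha> / (\<alpha> - 1))) powr (1 - \<alpha>)) \<longlonglongrightarrow> 0"
    using \<alpha> by (intro tendsto_neg_powr) auto
  note low = max_log_less[OF g0 lim]
  show "\<forall>\<^sub>F t in at_top. - ln (prob {\<omega> \<in> space M. ereal t < gF_max g X \<omega>}) / h t < k" if "0 < k" for k
    using low[OF that] by (auto elim: eventually_mono)
  show "\<forall>\<^sub>F t in at_top. k < - ln (prob {\<omega> \<in> space M. ereal t < gF_max g X \<omega>}) / h t" if "k < 0" for k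
    using low[OF zero_less_one]
  proof eventually_elim
    case (elim t)
    have "0 \<le> - ln (prob {\<omega> \<in> space M. ereal t < gF_max g X \<omega>}) / h t"
      using elim h_nonneg[of t] by (intro divide_nonneg_nonneg) auto
    then show ?case using that by linarith
  qed
qed

end

section \<open>Logarithmic asymptotics of the tail of the maximum\<close>

lemma conjugate_exponent:
  fixes \<alpha> \<beta> :: real
  assumes "1 < \<alpha>" "1 / \<alpha> + 1 / \<beta> = 1"
  shows "\<beta> = \<alpha> / (\<alpha> - 1)"
proof -
  have "\<beta> \<noteq> 0" using assms by auto
  then show ?thesis using assms by (simp add: field_simps)
qed

text \<open>
The exponents combine to \<open>- \<alpha> / \<beta> = 1 - \<alpha>\<close>.
\<close>

lemma enn2real_seq_norm_powr_summable:
  fixes g :: "nat \<Rightarrow> real"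
  assumes nn: "\<And>i. g i \<ge> 0" and s: "(\<lambda>i. g i powr \<beta>) sums B" and B: "B > 0"
    and \<alpha>: "1 < \<alpha>" and \<beta>: "\<beta> = \<alpha> / (\<alpha> - 1)"
  shows "enn2real (ennreal_powr (seq_norm \<beta> g) (- \<alpha>)) = B powr (1 - \<alpha>)"
proof -
  have \<beta>0: "\<beta> > 0" using \<alpha> \<beta> by simp
  have "(\<Sum>i. ennreal (\<bar>g i\<bar> powr \<beta>)) = ennreal B"
    by (simp only: abs_of_nonneg[OF nn] suminf_ennreal_eq[OF powr_ge_zero s])
  then have n: "seq_norm \<beta> g = ennreal (B powr (1 / \<beta>))"
    using B \<beta>0 by (simp add: seq_norm_def ennreal_powr_def)
  have "B powr (1 / \<beta>) > 0" using B by simp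
  then have "ennreal_powr (seq_norm \<beta> g) (- \<alpha>) = ennreal ((B powr (1 / \<beta>)) powr (- \<alpha>))"
    unfolding n using \<alpha> B by (simp add: ennreal_powr_def)
  also have "(B powr (1 / \<beta>)) powr (- \<alpha>) = B powr (1 - \<alpha>)"
    using \<alpha> by (simp add: powr_powr \<beta>)
  finally show ?thesis by simp
qed

lemma enn2real_seq_norm_powr_not_summable:
  fixes g :: "nat \<Rightarrow> real"
  assumes nn: "\<And>i. g i \<ge> 0" and s: "\<not> summable (\<lambda>i. g i powr \<beta>)" and \<alpha>: "0 < \<alpha>" and \<beta>: "0 < \<beta>"
  shows "enn2real (ennreal_powr (seq_norm \<beta> g) (- \<alpha>)) = 0"
proof -
  have "(\<Sum>i. ennreal (\<bar>g i\<bar> powr \<beta>)) = \<infinity>"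
    using summable_suminf_not_top[OF powr_ge_zero, of g "\<lambda>_. \<beta>"] s
    by (auto simp only: abs_of_nonneg[OF nn] infinity_ennreal_def)
  then show ?thesis using \<alpha> \<beta> by (simp add: seq_norm_def ennreal_powr_def)
qed

text \<open>
The only delicate point is that \<open>F < 1\<close> everywhere, so that the logarithm of the tail is meaningful:
otherwise the quotient in the definition of regular variation would eventually be \<open>0 / 0 = 0\<close> (as \<open>ln 0 = 0\<close>),
whereas its limit is positive.
\<close>

lemma moving_average_of_gF_setting:
  assumes set: "gF_setting M G g F X" and nn: "\<And>i. g i \<ge> 0" and dom: "{0..} \<subseteq> mgf_domain M (X 1)"
    and rv: "regularly_varying_at_infinity (\<lambda>t. - ln (1 - F t)) \<alpha>" and \<alpha>: "1 < \<alpha>"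
  shows "moving_average M g X (\<lambda>t. - ln (1 - F t)) \<alpha>"
proof -
  interpret prob_space M using set by (simp add: gF_setting_def)
  have indep: "indep_vars (\<lambda>_. borel) X {1..}" using set by (simp add: gF_setting_def)
  have F: "cdf (distr M borel (X i)) = F" if "i \<ge> 1" for i using set that by (simp add: gF_setting_def)
  have meas: "X i \<in> borel_measurable M" if "i \<ge> 1" for i using indep that unfolding indep_vars_def by auto
  have rd: "real_distribution (distr M borel (X i))" if "i \<ge> 1" for i
    using meas[OF that] by (rule real_distribution_distr)
  interpret D: real_distribution "distr M borel (X 1)" using rd by simp
  have F1: "cdf (distr M borel (X 1)) = F" using F by simp
  have monoF: "F x \<le> F y" if "x \<le> y" for x y using D.cdf_nondecreasing[OF that] unfolding F1 .
  have F_le: "F x \<le> 1" for x using D.cdf_bounded_prob[of x] unfolding F1 .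
  have F_lim: "(F \<longlongrightarrow> 1) at_top" using D.cdf_lim_at_top_prob unfolding F1 .
  have F_less: "F x < 1" for x
  proof (rule ccontr)
    assume "\<not> F x < 1"
    then have one: "F y = 1" if "y \<ge> x" for y using monoF[OF that] F_le[of y] by linarith
    have "((\<lambda>t. - ln (1 - F (2 * t)) / - ln (1 - F t)) \<longlongrightarrow> 2 powr \<alpha>) at_top"
      using rv unfolding regularly_varying_at_infinity_def by auto
    moreover have "\<forall>\<^sub>F t in at_top. - ln (1 - F (2 * t)) / - ln (1 - F t) = 0"
      using eventually_ge_at_top[of x] by eventually_elim (simp add: one)
    ultimately have "((\<lambda>t::real. 0::real) \<longlongrightarrow> 2 powr \<alpha>) at_top"
      by (rule Lim_transform_eventually)
    then have "(2::real) powr \<alpha> = 0" using tendsto_const_iff[OF trivial_limit_at_top_linorder] by metis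
    then show False by simp
  qed
  show ?thesis
  proof
    show "indep_vars (\<lambda>_. borel) X {1..}" by (rule indep)
    show "distr M borel (X i) = distr M borel (X 1)" if "1 \<le> i" for i
      using that F by (intro cdf_unique rd) auto
    show "g i \<ge> 0" for i by (rule nn)
    show "prob {\<omega> \<in> space M. x < X 1 \<omega>} = exp (- (- ln (1 - F x)))" for x
    proof -
      have "F x = prob (X 1 -` {..x} \<inter> space M)"
        using meas[of 1] unfolding F1[symmetric] cdf_def by (simp add: measure_distr)
      also have "X 1 -` {..x} \<inter> space M = {\<omega> \<in> space M. X 1 \<omega> \<le> x}" by auto
      finally have "prob {\<omega> \<in> space M. \<not> X 1 \<omega> \<le> x} = 1 - F x"
        using meas[of 1] by (subst prob_neg) auto
      then show ?thesis using F_less[of x] by (simp add: not_le)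
    qed
    show "mono (\<lambda>t. - ln (1 - F t))" using monoF F_less by (intro monoI) simp
    show "regularly_varying_at_infinity (\<lambda>t. - ln (1 - F t)) \<alpha>" by (rule rv)
    have "((\<lambda>t. 1 - F t) \<longlongrightarrow> 1 - 1) at_top" by (intro tendsto_intros F_lim)
    then have "filterlim (\<lambda>t. 1 - F t) (at_right 0) at_top"
      using F_less by (intro tendsto_imp_filterlim_at_right) auto
    from filterlim_compose[OF ln_at_0 this]
    show "filterlim (\<lambda>t. - ln (1 - F t)) at_top at_top" by (simp add: filterlim_uminus_at_top)
    show "1 < \<alpha>" by (rule \<alpha>)
    show "integrable M (\<lambda>\<omega>. exp (s * X 1 \<omega>))" if "0 \<le> s" for s
      using dom that by (auto simp: mgf_domain_def)
  qed
qed

text \<open>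
The case distinction is on the finiteness of \<open>|g|\<^sub>\<beta>\<close>. Finiteness forces \<open>g\<close> to tend to \<open>0\<close>, which gives access
to the asymptotic monotonicity of the coefficients that the upper bound relies on.
\<close>

theorem theorem2p2:
  fixes M :: "'a measure" and G :: "real \<Rightarrow> real" and g :: "nat \<Rightarrow> real"
    and F :: "real \<Rightarrow> real" and X :: "nat \<Rightarrow> 'a \<Rightarrow> real" and \<alpha> \<beta> \<gamma> :: real
  assumes "gF_setting M G g F X"
    and "ext_mean M (X 1) < 0"
    and "standard_assumption M G g X \<gamma>"
    and "1 / 2 < \<gamma>" and "\<gamma> < 1"
    and "regularly_varying_at_infinity (\<lambda>t. - ln (1 - F t)) \<alpha>"
    and "1 < \<alpha>" and "\<alpha> * \<gamma> < 1"
    and "1 / \<alpha> + 1 / \<beta> = 1"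
  shows "((\<lambda>t. ln (measure M {\<omega> \<in> space M. ereal t < gF_max g X \<omega>}) / ln (1 - F t))
           \<longlongrightarrow> enn2real (ennreal_powr (seq_norm \<beta> g) (- \<alpha>))) at_top"
proof -
  have nn: "\<And>i. g i \<ge> 0" and g0: "g 0 \<noteq> 0" and \<gamma>: "\<gamma> > 0" and rvG: "regularly_varying_at_1 G \<gamma>"
    and mon: "g \<longlonglongrightarrow> 0 \<Longrightarrow> \<exists>b. monoseq b \<and> g \<sim>[sequentially] b"
    and dom: "{0..} \<subseteq> mgf_domain M (X 1)"
    using assms(3) by (auto simp: standard_assumption_def)
  have sums: "\<And>x. x \<in> {-1<..<1} \<Longrightarrow> (\<lambda>i. g i * x ^ i) sums G x"
    using assms(1) by (simp add: gF_setting_def)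
  have g0: "g 0 > 0" using nn[of 0] g0 by simp
  have \<beta>: "\<beta> = \<alpha> / (\<alpha> - 1)" by (rule conjugate_exponent[OF assms(7,9)])
  have \<beta>0: "\<beta> > 0" using assms(7) by (simp add: \<beta>)
  interpret moving_average M g X "\<lambda>t. - ln (1 - F t)" \<alpha>
    by (rule moving_average_of_gF_setting[OF assms(1) nn dom assms(6,7)])
  have "((\<lambda>t. - ln (prob {\<omega> \<in> space M. ereal t < gF_max g X \<omega>}) / - ln (1 - F t))
           \<longlongrightarrow> enn2real (ennreal_powr (seq_norm \<beta> g) (- \<alpha>))) at_top"
  proof (cases "summable (\<lambda>i. g i powr \<beta>)")
    case True
    define B where "B = (\<Sum>i. g i powr \<beta>)"
    have sB: "(\<lambda>i. g i powr \<beta>) sums B" unfolding B_def using True by (rule summable_sums)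
    have "B > 0" unfolding B_def by (rule suminf_pos2[OF True, of 0]) (use g0 in auto)
    have "(\<lambda>i. (g i powr \<beta>) powr (1 / \<beta>)) \<longlonglongrightarrow> 0"
      by (rule tendsto_zero_powrI[OF summable_LIMSEQ_zero[OF True] tendsto_const]) (use \<beta>0 in auto)
    moreover have "(g i powr \<beta>) powr (1 / \<beta>) = g i" for i using nn[of i] \<beta>0 by (simp add: powr_powr)
    ultimately have lim: "g \<longlonglongrightarrow> 0" by simp
    then obtain b where b: "monoseq b" "g \<sim>[sequentially] b" using mon by blast
    obtain K where K: "\<And>i. g i \<le> K"
      using convergent_imp_Bseq[OF convergentI[OF lim]] unfolding Bseq_def by (auto simp: abs_le_iff)
    obtain \<eta> where \<eta>: "0 < \<eta>" "\<eta> < 1" "\<eta> < \<alpha> - 1" "summable (\<lambda>i. g i powr ((\<alpha> + \<eta>) / (\<alpha> + \<eta> - 1)))"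
      "\<And>a. a > 0 \<Longrightarrow> summable (\<lambda>n. exp (- a * (\<Sum>i<n. g i)))"
      using regularly_varying_coefficients[OF sums nn rvG \<gamma> assms(7,8) lim b] by blast
    show ?thesis
      unfolding enn2real_seq_norm_powr_summable[OF nn sB \<open>B > 0\<close> assms(7) \<beta>]
      by (rule max_log_limit_summable[OF assms(2) g0 K \<eta> sB[unfolded \<beta>] \<open>B > 0\<close>])
  next
    case False
    have "\<alpha> > 0" using assms(7) by simp
    show ?thesis
      unfolding enn2real_seq_norm_powr_not_summable[OF nn False \<open>\<alpha> > 0\<close> \<beta>0]
      by (rule max_log_limit_not_summable[OF g0 False[unfolded \<beta>]])
  qed
  then show ?thesis by simp
qed

end
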